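(* Let $\alpha\in(0,\pi/2)$, $\Delta=\Delta(\alpha)$, $1\le p<\infty$, let $v:\Delta\to\mathbb{R}$ be an admissible weight function and let $\mathcal{T}=\{T_t\}_{t\in\Delta}$ be the translation $C_0$-semigroup on $X=L^p_v(\Delta(\alpha))$. If there exists a subset $K\subset\mathbb{N}$ with $\overline{\mathrm{dens}}(K)=1$ such that $$\sum_{k\in K}\int_{\Delta_{k,k+1}}v(s)\,ds<\infty,$$ where $\Delta_{k,k+1}=\{t\in\Delta:k\le|t|\le k+1\}$, then the translation $C_0$-semigroup $\mathcal{T}=\{T_t\}_{t\in\Delta}$ is densely distributionally chaotic.
   Context: The complex sector is $\Delta(\alpha)=\{re^{i\theta}\in\mathbb{C}: r\ge 0,\ |\theta|\le\alpha\}$ with $\alpha\in(0,\pi/2)$; $\Delta_r=\{t\in\Delta:|t|<r\}$ for $r>0$. $\mathbb{N}$ is the set of positive integers. With $\mu$ the (planar) Lebesgue measure, the upper density of a measurable $A\subset\Delta$ is $\overline{\mathrm{dens}}(A)=\limsup_{r\to\infty}\mu(A\cap\Delta_r)/\mu(\Delta_r)$; for $K\subset\mathbb{N}$, $\overline{\mathrm{dens}}(K)=\limsup_{n\to\infty}\#(K\cap[1,n])/n$. A measurable function $v:\Delta\to\mathbb{R}$ is an admissible weight function if $v(t)>0$ for all $t\in\Delta$ and there are constants $M\ge1$, $w\in\mathbb{R}$ with $v(t)\le Me^{w|t'|}v(t+t')$ for all $t,t'\in\Delta$. For $\mathbb{K}=\mathbb{R}$ or $\mathbb{C}$, $L^p_v(\Delta)$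 is the Banach space of (classes of) measurable $f:\Delta\to\mathbb{K}$ with $\|f\|=\left(\int_\Delta|f(t)|^pv(t)\,dt\right)^{1/p}<\infty$. The translation semigroup is $(T_tf)(s)=f(s+t)$ for $s,t\in\Delta$; admissibility makes it a $C_0$-semigroup (i.e. $T_0=I$, $T_tT_s=T_{t+s}$, and $t\mapsto T_tf$ is norm continuous for each $f$). A pair $(f,g)\in X\times X$ is distributionally chaotic if there is $\delta>0$ such that $\overline{\mathrm{dens}}(\{t\in\Delta:\|T_tf-T_tg\|<\varepsilon\})=1$ for every $\varepsilon>0$ and $\overline{\mathrm{dens}}(\{t\in\Delta:\|T_tf-T_tg\|>\delta\})=1$. A distributionally scrambled set is an uncountable set $S\subset X$ such that any two distinct points of $S$ form a distributionally chaotic pair. $\mathcal{T}$ is densely distributionally chaotic if it admits a dense distributionally scrambled set. *)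

theory Defs
  imports "HOL-Analysis.Analysis"
begin

definition sector :: "real \<Rightarrow> complex set" where
  "sector \<alpha> = {rcis r \<theta> | r \<theta>. 0 \<le> r \<and> \<bar>\<theta>\<bar> \<le> \<alpha>}"

definition sector_ball :: "real \<Rightarrow> real \<Rightarrow> complex set" where
  "sector_ball \<alpha> r = {t \<in> sector \<alpha>. norm t < r}"

definition sector_annulus :: "real \<Rightarrow> real \<Rightarrow> real \<Rightarrow> complex set" where
  "sector_annulus \<alpha> a b = {t \<in> sector \<alpha>. a \<le> norm t \<and> norm t \<le> b}"

(* Intended for Lebesgue measurable A. The library assigns measure 0 to non-measurable sets,
   which can only lower this density. *)
definition sector_upper_density :: "real \<Rightarrow> complex set \<Rightarrow> ereal" where
  "sector_upper_density \<alpha> A =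
     Limsup at_top (\<lambda>r::real.
       ereal (measure lebesgue (A \<inter> sector_ball \<alpha> r) / measure lebesgue (sector_ball \<alpha> r)))"

definition nat_upper_density :: "nat set \<Rightarrow> ereal" where
  "nat_upper_density K = limsup (\<lambda>n. ereal (real (card (K \<inter> {1..n})) / real n))"

definition admissible_weight :: "real \<Rightarrow> (complex \<Rightarrow> real) \<Rightarrow> bool" where
  "admissible_weight \<alpha> v \<longleftrightarrow>
     v \<in> borel_measurable (lebesgue_on (sector \<alpha>)) \<and>
     (\<forall>t\<in>sector \<alpha>. v t > 0) \<and>
     (\<exists>M w. M \<ge> 1 \<and>
        (\<forall>t\<in>sector \<alpha>. \<forall>t'\<in>sector \<alpha>. v t \<le> M * exp (w * norm t') * v (t + t')))"

text \<open>
  Functions on the sector are represented by total functions on the plane. Their values outside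
  the sector play no role: measurability, integrals and the almost-everywhere equivalence all
  refer to \<^term>\<open>lebesgue_on (sector \<alpha>)\<close>.
\<close>

definition Lp_fun :: "real \<Rightarrow> real \<Rightarrow> (complex \<Rightarrow> real) \<Rightarrow> (complex \<Rightarrow> 'a::real_normed_vector) set" where
  "Lp_fun \<alpha> p v =
     {f \<in> borel_measurable (lebesgue_on (sector \<alpha>)).
        integrable (lebesgue_on (sector \<alpha>)) (\<lambda>t. norm (f t) powr p * v t)}"

definition Lp_seminorm :: "real \<Rightarrow> real \<Rightarrow> (complex \<Rightarrow> real) \<Rightarrow> (complex \<Rightarrow> 'a::real_normed_vector) \<Rightarrow> real" where
  "Lp_seminorm \<alpha> p v f =
     (integral\<^sup>L (lebesgue_on (sector \<alpha>)) (\<lambda>t. norm (f t) powr p * v t)) powr (1 / p)"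

definition ae_class :: "real \<Rightarrow> (complex \<Rightarrow> 'a::real_normed_vector) \<Rightarrow> (complex \<Rightarrow> 'a) set" where
  "ae_class \<alpha> f =
     {g \<in> borel_measurable (lebesgue_on (sector \<alpha>)). AE t in lebesgue_on (sector \<alpha>). g t = f t}"

definition Lp_space :: "real \<Rightarrow> real \<Rightarrow> (complex \<Rightarrow> real) \<Rightarrow> (complex \<Rightarrow> 'a::real_normed_vector) set set" where
  "Lp_space \<alpha> p v = ae_class \<alpha> ` Lp_fun \<alpha> p v"

text \<open>Operations on classes are defined through an arbitrarily chosen representative.\<close>

definition class_rep :: "(complex \<Rightarrow> 'a::real_normed_vector) set \<Rightarrow> complex \<Rightarrow> 'a" where
  "class_rep F = (SOME f. f \<in> F)"

definition class_diff :: "real \<Rightarrow> (complex \<Rightarrow> 'a::real_normed_vector) set \<Rightarrow> (complex \<Rightarrow> 'a) set \<Rightarrow> (complex \<Rightarrow> 'a) set" where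
  "class_diff \<alpha> F G = ae_class \<alpha> (\<lambda>s. class_rep F s - class_rep G s)"

definition Lp_norm :: "real \<Rightarrow> real \<Rightarrow> (complex \<Rightarrow> real) \<Rightarrow> (complex \<Rightarrow> 'a::real_normed_vector) set \<Rightarrow> real" where
  "Lp_norm \<alpha> p v F = Lp_seminorm \<alpha> p v (class_rep F)"

definition Lp_dist :: "real \<Rightarrow> real \<Rightarrow> (complex \<Rightarrow> real) \<Rightarrow> (complex \<Rightarrow> 'a::real_normed_vector) set \<Rightarrow> (complex \<Rightarrow> 'a) set \<Rightarrow> real" where
  "Lp_dist \<alpha> p v F G = Lp_norm \<alpha> p v (class_diff \<alpha> F G)"

definition translation :: "real \<Rightarrow> complex \<Rightarrow> (complex \<Rightarrow> 'a::real_normed_vector) set \<Rightarrow> (complex \<Rightarrow> 'a) set" where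
  "translation \<alpha> t F = ae_class \<alpha> (\<lambda>s. class_rep F (s + t))"

text \<open>
  The notions of chaos below are stated for any family \<open>T\<close> of maps, indexed by the
  sector, on a set \<open>X\<close> with metric \<open>d\<close>.
\<close>

definition dist_chaotic_pair ::
    "real \<Rightarrow> ('x \<Rightarrow> 'x \<Rightarrow> real) \<Rightarrow> (complex \<Rightarrow> 'x \<Rightarrow> 'x) \<Rightarrow> 'x \<Rightarrow> 'x \<Rightarrow> bool" where
  "dist_chaotic_pair \<alpha> d T f g \<longleftrightarrow>
     (\<exists>\<delta>>0.
        (\<forall>\<epsilon>>0. sector_upper_density \<alpha> {t \<in> sector \<alpha>. d (T t f) (T t g) < \<epsilon>} = 1) \<and>
        sector_upper_density \<alpha> {t \<in> sector \<alpha>. d (T t f) (T t g) > \<delta>} = 1)"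

definition dist_scrambled_set ::
    "real \<Rightarrow> 'x set \<Rightarrow> ('x \<Rightarrow> 'x \<Rightarrow> real) \<Rightarrow> (complex \<Rightarrow> 'x \<Rightarrow> 'x) \<Rightarrow> 'x set \<Rightarrow> bool" where
  "dist_scrambled_set \<alpha> X d T S \<longleftrightarrow>
     S \<subseteq> X \<and> uncountable S \<and> (\<forall>f\<in>S. \<forall>g\<in>S. f \<noteq> g \<longrightarrow> dist_chaotic_pair \<alpha> d T f g)"

definition densely_dist_chaotic ::
    "real \<Rightarrow> 'x set \<Rightarrow> ('x \<Rightarrow> 'x \<Rightarrow> real) \<Rightarrow> (complex \<Rightarrow> 'x \<Rightarrow> 'x) \<Rightarrow> bool" where
  "densely_dist_chaotic \<alpha> X d T \<longleftrightarrow>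
     (\<exists>S. dist_scrambled_set \<alpha> X d T S \<and> (\<forall>f\<in>X. \<forall>\<epsilon>>0. \<exists>g\<in>S. d f g < \<epsilon>))"

end

theory Submission imports Defs begin

text \<open>
  Let \<open>h\<close> be constant on the shells \<open>k \<le> \<bar>s\<bar> < k + 1\<close> with \<open>k\<close> in \<open>K \<inter> J\<close>, and zero elsewhere, where \<open>J\<close>
  consists of rapidly growing blocks separated by long gaps. If three consecutive shells around \<open>\<bar>t\<bar>\<close>
  are charged, the norm of \<open>T\<^sub>t h\<close> is bounded below by the mass of \<open>v\<close> near the origin; the blocks are
  so long that this happens with upper density one. If \<open>\<bar>t\<bar>\<close> lies in a gap, \<open>T\<^sub>t h\<close> only sees the
  shells beyond the gap, whose total mass can be made small compared with the growth factor
  \<open>M exp (w \<bar>t\<bar>)\<close> of admissibility, so the norm is small, again with upper density one.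

  For functions \<open>g\<close> with bounded support, \<open>T\<^sub>t g\<close> vanishes for large \<open>t\<close>. Hence any two of the
  functions \<open>g + \<rho> h\<close> with different coefficients \<open>\<rho>\<close> form a chaotic pair. There are only continuum
  many continuous \<open>g\<close>, so each pair \<open>(g, n)\<close> can be given its own coefficient, with \<open>\<rho> \<rightarrow> 0\<close> as \<open>n\<close>
  grows. Continuous functions with bounded support being dense, so are these functions.
\<close>

subsection \<open>Upper densities of sets of naturals\<close>

text \<open>Otherwise the proportion of \<open>K\<close> in \<open>{1..n}\<close> would eventually
  be at most \<open>1 - \<epsilon>\<close>, and the limsup could not reach 1.\<close>

lemma nat_upper_density_one_frequently:
  assumes K: "nat_upper_density K = 1" and \<epsilon>: "\<epsilon> > 0"
  shows "\<exists>n\<ge>N. real (card ({1..n} - K)) \<le> \<epsilon> * real n"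
proof (rule ccontr)
  assume neg: "\<not> ?thesis"
  have "\<forall>\<^sub>F n in sequentially. ereal (real (card (K \<inter> {1..n})) / real n) \<le> ereal (1 - \<epsilon>)"
    using eventually_ge_at_top[of "max N 1"]
  proof eventually_elim
    case (elim n)
    have "card {1..n} = card (K \<inter> {1..n}) + card ({1..n} - K)"
      by (metis Int_commute card_Int_Diff finite_atLeastAtMost)
    then have "real (card (K \<inter> {1..n})) + real (card ({1..n} - K)) = real n" by simp
    moreover have "real (card ({1..n} - K)) > \<epsilon> * real n" using neg elim by (metis max.boundedE not_le)
    ultimately show ?case using elim by (simp add: divide_simps algebra_simps)
  qed
  then have "nat_upper_density K \<le> ereal (1 - \<epsilon>)"
    unfolding nat_upper_density_def by (intro Limsup_bounded)
  then show False using K \<epsilon> by (simp add: one_ereal_def)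
qed

text \<open>
  The blocks making up \<open>J\<close> are \<open>[\<phi> ((j + 1) e\<^sub>j), e\<^sub>j\<^sub>+\<^sub>1)\<close>, where \<open>e\<close> grows so fast that \<open>K\<close> nearly fills
  \<open>[1, e\<^sub>j\<^sub>+\<^sub>1]\<close> and everything below the block is negligible.
\<close>

lemma upper_density_one_with_gaps:
  fixes \<phi> :: "nat \<Rightarrow> nat"
  assumes K: "nat_upper_density K = 1" and \<phi>: "\<And>x. x \<le> \<phi> x"
  obtains J where
    "\<And>\<epsilon> N. \<epsilon> > 0 \<Longrightarrow> \<exists>n>N. real (card ({..<n} - K \<inter> J)) \<le> \<epsilon> * real n"
    "\<And>m. \<exists>a>m. \<forall>k\<in>J. k < a \<or> \<phi> (Suc m * a) \<le> k"
proof -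
  have "\<exists>e. \<forall>j. j < e j \<and> (\<phi> (Suc j * e j) < e (Suc j) \<and>
    real (card ({1..e (Suc j)} - K)) + real (\<phi> (Suc j * e j)) + 1 \<le> real (e (Suc j)) / real (Suc j))"
  proof (rule dependent_nat_choice)
    show "\<exists>x::nat. 0 < x" by auto
    fix x n :: nat assume x: "n < x"
    define c where "c = \<phi> (Suc n * x)"
    \<comment> \<open>Half of the budget \<open>y / (n + 1)\<close> pays for the points missing from
      \<open>K\<close>, the other half for everything up to the start \<open>c\<close> of the
      block.\<close>
    obtain y where y: "y \<ge> 2 * Suc n * (c + 1)"
        "real (card ({1..y} - K)) \<le> 1 / (2 * real (Suc n)) * real y"
      using nat_upper_density_one_frequently[OF K, of "1 / (2 * real (Suc n))"] by auto
    have "x \<le> Suc n * x" by simp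
    also have "\<dots> \<le> c" unfolding c_def by (rule \<phi>)
    finally have "x \<le> c" .
    have "c < 2 * Suc n * (c + 1)" by simp
    then have "c < y" using y by linarith
    have "real (2 * Suc n * (c + 1)) \<le> real y" using y(1) of_nat_le_iff by blast
    then have "real c + 1 \<le> real y / (2 * real (Suc n))" by (simp add: field_simps)
    with y(2) have "real (card ({1..y} - K)) + real c + 1 \<le> real y / real (Suc n)"
      by (simp add: field_simps)
    with \<open>x \<le> c\<close> \<open>c < y\<close> x show "\<exists>y>Suc n. \<phi> (Suc n * x) < y \<and>
        real (card ({1..y} - K)) + real (\<phi> (Suc n * x)) + 1 \<le> real y / real (Suc n)"
      unfolding c_def by (intro exI[of _ y]) auto
  qed
  then obtain e where e: "\<And>j. j < e j" "\<And>j. \<phi> (Suc j * e j) < e (Suc j)"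
    "\<And>j. real (card ({1..e (Suc j)} - K)) + real (\<phi> (Suc j * e j)) + 1
        \<le> real (e (Suc j)) / real (Suc j)"
    by blast
  have le1: "e j \<le> \<phi> (Suc j * e j)" for j
    by (rule order_trans[OF _ \<phi>]) simp
  have "e j \<le> e (Suc j)" for j using le1[of j] e(2)[of j] by linarith
  then have "mono e" by (rule mono_iff_le_Suc[THEN iffD2, rule_format])
  define J where "J = {k. \<exists>j. \<phi> (Suc j * e j) \<le> k \<and> k < e (Suc j)}"
  show ?thesis
  proof (rule that[of J])
    fix \<epsilon> :: real and N :: nat assume "\<epsilon> > 0"
    then obtain j0 where j0: "1 / real (Suc j0) < \<epsilon>"
      using nat_approx_posE by blast
    define j where "j = max N j0"
    have "1 / real (Suc j) \<le> 1 / real (Suc j0)" by (intro divide_left_mono) (auto simp: j_def)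
    then have j: "1 / real (Suc j) < \<epsilon>" using j0 by linarith
    let ?n = "e (Suc j)"
    \<comment> \<open>The index 0 is listed separately: \<open>{..<?n}\<close> starts at 0, while
      the points missing from \<open>K\<close> are counted from 1.\<close>
    have "{..<?n} - K \<inter> J \<subseteq> ({1..?n} - K) \<union> {..<\<phi> (Suc j * e j)} \<union> {0}"
      unfolding J_def by force
    then have "card ({..<?n} - K \<inter> J) \<le> card (({1..?n} - K) \<union> {..<\<phi> (Suc j * e j)} \<union> {0})"
      by (intro card_mono) auto
    also have "\<dots> \<le> card (({1..?n} - K) \<union> {..<\<phi> (Suc j * e j)}) + card {0::nat}" by (rule card_Un_le)
    also have "\<dots> \<le> card ({1..?n} - K) + card {..<\<phi> (Suc j * e j)} + 1"
      using card_Un_le[of "{1..?n} - K" "{..<\<phi> (Suc j * e j)}"] by simp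
    finally have "card ({..<?n} - K \<inter> J) \<le> card ({1..?n} - K) + \<phi> (Suc j * e j) + 1" by simp
    then have "real (card ({..<?n} - K \<inter> J)) \<le> real ?n / real (Suc j)"
      using e(3)[of j] by linarith
    also have "\<dots> \<le> \<epsilon> * real ?n"
      using mult_right_mono[OF less_imp_le[OF j], of "real ?n"] by simp
    finally show "\<exists>n>N. real (card ({..<n} - K \<inter> J)) \<le> \<epsilon> * real n"
      using e(1)[of "Suc j"] by (intro exI[of _ ?n]) (auto simp: j_def)
  next
    fix m :: nat
    have "k < e m \<or> \<phi> (Suc m * e m) \<le> k" if kJ: "k \<in> J" for k
    proof -
      obtain i where i: "\<phi> (Suc i * e i) \<le> k" "k < e (Suc i)"
        using kJ unfolding J_def by blast
      \<comment> \<open>Blocks with index below \<open>m\<close> end by \<open>e m\<close>; block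
        \<open>m\<close> and all later ones start no earlier than
        \<open>\<phi> (Suc m * e m)\<close>. So \<open>e m\<close> serves as
        \<open>a\<close>.\<close>
      consider "i < m" | "i = m" | "m < i" by linarith
      then show ?thesis
      proof cases
        case 1
        then have "e (Suc i) \<le> e m" using \<open>mono e\<close> by (simp add: mono_def)
        then show ?thesis using i by simp
      next
        case 3
        then have "e (Suc m) \<le> e i" using \<open>mono e\<close> by (simp add: mono_def)
        then show ?thesis using i e(2)[of m] le1[of i] by simp
      qed (use i in simp)
    qed
    then show "\<exists>a>m. \<forall>k\<in>J. k < a \<or> \<phi> (Suc m * a) \<le> k" using e(1) by blast
  qed
qed

text \<open>Each point missing from \<open>H\<close> spoils at most three indices: itself and its
  two neighbours. The number of failures is thus at most three times as large, up to two boundary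
  indices.\<close>

lemma frequently_card_three_consecutive:
  fixes H :: "nat set"
  assumes H: "\<And>\<epsilon> N. 0 < \<epsilon> \<Longrightarrow> \<exists>n>N. real (card ({..<n} - H)) \<le> \<epsilon> * real n" and "0 < \<epsilon>"
  shows "\<exists>n>N. real (card ({..<n} - {k. 0 < k \<and> k - 1 \<in> H \<and> k \<in> H \<and> k + 1 \<in> H})) \<le> \<epsilon> * real n"
proof -
  \<comment> \<open>Three quarters of \<open>\<epsilon> * n\<close> go to the three copies of the
    missing set; the last quarter absorbs the constant 2 once \<open>n\<close> exceeds
    \<open>8 / \<epsilon>\<close>.\<close>
  obtain n where n: "n > max N (nat \<lceil>8 / \<epsilon>\<rceil>)" "real (card ({..<n} - H)) \<le> \<epsilon> / 4 * real n"
    using H[of "\<epsilon> / 4"] \<open>0 < \<epsilon>\<close> by (metis zero_less_divide_iff zero_less_numeral)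
  let ?B = "{..<n} - H"
  \<comment> \<open>The index \<open>n - 1\<close> is an exception because its successor
    \<open>n\<close> lies outside the range in which missing points are counted.\<close>
  have "{..<n} - {k. 0 < k \<and> k - 1 \<in> H \<and> k \<in> H \<and> k + 1 \<in> H}
      \<subseteq> {0, n - 1} \<union> ?B \<union> (Suc ` ?B \<union> (\<lambda>k. k - 1) ` ?B)" (is "?L \<subseteq> _")
  proof
    fix k assume k: "k \<in> ?L"
    consider "k = 0" | "k = n - 1" | "k \<notin> H" | "k > 0" "k - 1 \<notin> H" | "k + 1 < n" "k + 1 \<notin> H"
      using k by fastforce
    then show "k \<in> {0, n - 1} \<union> ?B \<union> (Suc ` ?B \<union> (\<lambda>k. k - 1) ` ?B)"
    proof cases
      case 4
      then have "k = Suc (k - 1)" "k - 1 \<in> ?B" using k by auto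
      then show ?thesis by blast
    next
      case 5
      then have "k = (k + 1) - 1" "k + 1 \<in> ?B" by auto
      then show ?thesis by blast
    qed (use k in auto)
  qed
  then have "card ?L \<le> card ({0, n - 1} \<union> ?B \<union> (Suc ` ?B \<union> (\<lambda>k. k - 1) ` ?B))"
    by (intro card_mono) auto
  also have "\<dots> \<le> card ({0, n - 1} \<union> ?B) + card (Suc ` ?B \<union> (\<lambda>k. k - 1) ` ?B)" by (rule card_Un_le)
  also have "\<dots> \<le> (card {0, n - 1} + card ?B) + (card (Suc ` ?B) + card ((\<lambda>k. k - 1) ` ?B))"
    by (intro add_mono card_Un_le)
  also have "\<dots> \<le> (2 + card ?B) + (card ?B + card ?B)"
    by (intro add_mono card_image_le) (auto simp: card_insert_if)
  finally have "real (card ?L) \<le> 2 + 3 * real (card ?B)" by linarith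
  also have "\<dots> \<le> 2 + 3 * (\<epsilon> / 4 * real n)" using n(2) by linarith
  also have "8 / \<epsilon> < real n" using n(1) by linarith
  then have "2 \<le> \<epsilon> / 4 * real n" using \<open>0 < \<epsilon>\<close> by (simp add: field_simps)
  then have "2 + 3 * (\<epsilon> / 4 * real n) \<le> \<epsilon> * real n" by linarith
  finally show ?thesis using n(1) by (intro exI[of _ n]) auto
qed

subsection \<open>Upper density in the sector\<close>

locale proper_sector =
  fixes \<alpha> :: real
  assumes \<alpha>_pos: "0 < \<alpha>" and \<alpha>_less: "\<alpha> < pi / 2"
begin

lemma tan_\<alpha>_pos: "0 < tan \<alpha>"
  using \<alpha>_pos \<alpha>_less by (rule tan_gt_zero)

text \<open>Since \<alpha> < pi / 2, the cosine is positive on all admissible angles and the tangent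
  is monotone there; conversely the angle is recovered as an arctangent. In this linear form it is
  plain that the sector is a closed cone stable under addition.\<close>

lemma sector_iff: "z \<in> sector \<alpha> \<longleftrightarrow> \<bar>Im z\<bar> \<le> tan \<alpha> * Re z"
proof
  assume "z \<in> sector \<alpha>"
  then obtain r \<theta> where z: "z = rcis r \<theta>" "0 \<le> r" "\<bar>\<theta>\<bar> \<le> \<alpha>" by (auto simp: sector_def)
  then have cos: "0 < cos \<theta>" using \<alpha>_less by (intro cos_gt_zero_pi) auto
  have "tan \<bar>\<theta>\<bar> \<le> tan \<alpha>" using z \<alpha>_less \<alpha>_pos by (intro tan_mono_le) auto
  moreover have "tan \<bar>\<theta>\<bar> = \<bar>sin \<theta>\<bar> / cos \<theta>"
    using cos z \<alpha>_less sin_ge_zero[of "\<bar>\<theta>\<bar>"] by (cases "\<theta> \<ge> 0") (auto simp: tan_def abs_if)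
  ultimately have "\<bar>sin \<theta>\<bar> \<le> tan \<alpha> * cos \<theta>" using cos by (simp add: field_simps)
  then have "r * \<bar>sin \<theta>\<bar> \<le> r * (tan \<alpha> * cos \<theta>)" using z by (intro mult_left_mono) auto
  then show "\<bar>Im z\<bar> \<le> tan \<alpha> * Re z" using z by (simp add: abs_mult ac_simps)
next
  assume le: "\<bar>Im z\<bar> \<le> tan \<alpha> * Re z"
  show "z \<in> sector \<alpha>"
  proof (cases "z = 0")
    case True
    then show ?thesis using \<alpha>_pos unfolding sector_def by (auto intro!: exI[of _ 0])
  next
    case False
    have "0 \<le> tan \<alpha> * Re z" using le by linarith
    then have "0 \<le> Re z" using tan_\<alpha>_pos by (simp add: zero_le_mult_iff)
    moreover have "Re z \<noteq> 0" using False le by (auto simp: complex_eq_iff)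
    ultimately have re: "0 < Re z" by simp
    define \<theta> where "\<theta> = arctan (Im z / Re z)"
    have "\<bar>Im z / Re z\<bar> \<le> tan \<alpha>" using le re by (simp add: field_simps)
    then have "Im z / Re z \<le> tan \<alpha>" "- (Im z / Re z) \<le> tan \<alpha>" by linarith+
    then have "\<theta> \<le> arctan (tan \<alpha>)" "- \<theta> \<le> arctan (tan \<alpha>)"
      unfolding \<theta>_def arctan_minus[symmetric] by (simp_all only: arctan_le_iff)
    then have "\<bar>\<theta>\<bar> \<le> arctan (tan \<alpha>)" by linarith
    also have "arctan (tan \<alpha>) = \<alpha>" using \<alpha>_pos \<alpha>_less by (intro arctan_tan) auto
    finally have "\<bar>\<theta>\<bar> \<le> \<alpha>" .
    have cos: "0 < cos \<theta>" using \<open>\<bar>\<theta>\<bar> \<le> \<alpha>\<close> \<alpha>_less by (intro cos_gt_zero_pi) auto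
    have "sin \<theta> = tan \<theta> * cos \<theta>" using cos by (simp add: tan_def)
    also have "tan \<theta> = Im z / Re z" by (simp add: \<theta>_def tan_arctan)
    finally have sin: "sin \<theta> = Im z / Re z * cos \<theta>" .
    have "z = rcis (Re z / cos \<theta>) \<theta>"
      using cos re by (simp add: complex_eq_iff sin)
    moreover have "0 \<le> Re z / cos \<theta>" using re cos by simp
    ultimately show ?thesis using \<open>\<bar>\<theta>\<bar> \<le> \<alpha>\<close> unfolding sector_def by blast
  qed
qed

lemma Re_sector_nonneg: "z \<in> sector \<alpha> \<Longrightarrow> 0 \<le> Re z"
  using tan_\<alpha>_pos unfolding sector_iff by (metis abs_ge_zero order_trans zero_le_mult_iff not_le)

lemma sector_add: "s \<in> sector \<alpha> \<Longrightarrow> t \<in> sector \<alpha> \<Longrightarrow> s + t \<in> sector \<alpha>"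
  unfolding sector_iff by (simp add: algebra_simps abs_le_iff)

lemma sector_scaleR_iff: "0 < c \<Longrightarrow> c *\<^sub>R z \<in> sector \<alpha> \<longleftrightarrow> z \<in> sector \<alpha>"
  unfolding sector_iff by (simp add: abs_mult mult.left_commute[of _ c])

lemma norm_le_Re: "z \<in> sector \<alpha> \<Longrightarrow> norm z \<le> (1 + tan \<alpha>) * Re z"
  using cmod_le[of z] Re_sector_nonneg[of z] unfolding sector_iff by (simp add: algebra_simps)

text \<open>Adding a sector element does not decrease the real part, and in the sector the real part
  controls the norm. Hence a large shift \<open>t\<close> moves the whole sector away from the
  origin, up to the factor \<open>1 + tan \<alpha>\<close>.\<close>

lemma norm_le_norm_add:
  assumes "s \<in> sector \<alpha>" "t \<in> sector \<alpha>"
  shows "norm t \<le> (1 + tan \<alpha>) * norm (s + t)"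
proof -
  have "norm t \<le> (1 + tan \<alpha>) * Re t" by (rule norm_le_Re) fact
  also have "\<dots> \<le> (1 + tan \<alpha>) * norm (s + t)"
    using Re_sector_nonneg[OF assms(1)] complex_Re_le_cmod[of "s + t"] tan_\<alpha>_pos
    by (intro mult_left_mono) auto
  finally show ?thesis .
qed

lemma closed_sector: "closed (sector \<alpha>)"
proof -
  have "sector \<alpha> = {z. \<bar>Im z\<bar> \<le> tan \<alpha> * Re z}" by (auto simp: sector_iff)
  also have "closed \<dots>" by (intro closed_Collect_le continuous_intros)
  finally show ?thesis .
qed

lemma sector_borel [measurable]: "sector \<alpha> \<in> sets borel"
  by (rule borel_closed[OF closed_sector])

lemma sector_lebesgue [measurable]: "sector \<alpha> \<in> sets lebesgue"
  using sector_borel by simp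

lemma sector_ball_borel [measurable]: "sector_ball \<alpha> r \<in> sets borel"
proof -
  have "sector_ball \<alpha> r = sector \<alpha> \<inter> ball 0 r" by (auto simp: sector_ball_def)
  then show ?thesis by simp
qed

lemma sector_ball_lmeasurable [simp]: "sector_ball \<alpha> r \<in> lmeasurable"
proof (rule bounded_set_imp_lmeasurable)
  show "bounded (sector_ball \<alpha> r)"
    by (rule bounded_subset[OF bounded_ball[of 0 r]]) (auto simp: sector_ball_def)
  show "sector_ball \<alpha> r \<in> sets lebesgue" using sector_ball_borel by simp
qed

lemma sector_ball_not_negligible: "0 < r \<Longrightarrow> \<not> negligible (sector_ball \<alpha> r)"
proof
  assume r: "0 < r" and neg: "negligible (sector_ball \<alpha> r)"
  let ?U = "{z. \<bar>Im z\<bar> < tan \<alpha> * Re z} \<inter> ball 0 r"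
  have "?U \<subseteq> sector_ball \<alpha> r" by (auto simp: sector_ball_def sector_iff)
  then have "negligible ?U" using neg negligible_subset by blast
  moreover have "open ?U" by (intro open_Int open_Collect_less continuous_intros) auto
  moreover have "complex_of_real (r / 2) \<in> ?U" using r tan_\<alpha>_pos by simp
  ultimately show False using open_not_negligible by blast
qed

text \<open>The sector is a cone, so the ball is the image of the unit one under scaling by
  \<open>r\<close>, which multiplies planar area by the square of \<open>r\<close>.\<close>

lemma measure_sector_ball:
  assumes "0 < r"
  shows "measure lebesgue (sector_ball \<alpha> r) = r\<^sup>2 * measure lebesgue (sector_ball \<alpha> 1)"
proof -
  have "sector_ball \<alpha> r = (\<lambda>x. r *\<^sub>R x + 0) ` sector_ball \<alpha> 1"
  proof (intro equalityI subsetI)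
    fix z assume "z \<in> sector_ball \<alpha> r"
    then have "inverse r *\<^sub>R z \<in> sector \<alpha>" "norm z < r"
      using assms by (auto simp: sector_ball_def sector_scaleR_iff)
    moreover have "norm (inverse r *\<^sub>R z) = norm z / r"
      using assms by (simp add: divide_inverse_commute del: scaleR_conv_of_real)
    ultimately have "inverse r *\<^sub>R z \<in> sector_ball \<alpha> 1"
      using assms unfolding sector_ball_def by simp
    moreover have "z = r *\<^sub>R (inverse r *\<^sub>R z) + 0" using assms by simp
    ultimately show "z \<in> (\<lambda>x. r *\<^sub>R x + 0) ` sector_ball \<alpha> 1" by (rule rev_image_eqI)
  next
    fix z assume "z \<in> (\<lambda>x. r *\<^sub>R x + 0) ` sector_ball \<alpha> 1"
    then obtain x where "x \<in> sector \<alpha>" "norm x < 1" "z = r *\<^sub>R x" by (auto simp: sector_ball_def)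
    then show "z \<in> sector_ball \<alpha> r"
      using assms by (simp add: sector_ball_def sector_scaleR_iff del: scaleR_conv_of_real)
  qed
  then show ?thesis using measure_lebesgue_affine[of r 0 "sector_ball \<alpha> 1"] by simp
qed

lemma measure_sector_ball_pos: "0 < r \<Longrightarrow> 0 < measure lebesgue (sector_ball \<alpha> r)"
  using sector_ball_not_negligible[of r] negligible_iff_measure0[OF sector_ball_lmeasurable]
  by (metis measure_nonneg order_le_less)

text \<open>A limsup only asks for arbitrarily large radii: a density below some
  \<open>c < 1\<close> would keep the ratio below \<open>c\<close> from some radius on, against the
  bound for \<open>\<epsilon> = 1 - c\<close>. Measurability of \<open>A\<close> makes the two parts
  of the ball add up.\<close>

lemma sector_upper_density_eq_1I:
  assumes A: "A \<in> sets lebesgue"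
    and ev: "\<And>\<epsilon> R. 0 < \<epsilon> \<Longrightarrow> \<exists>r>R. measure lebesgue (sector_ball \<alpha> r - A) \<le> \<epsilon> * measure lebesgue (sector_ball \<alpha> r)"
  shows "sector_upper_density \<alpha> A = 1"
proof (rule antisym)
  let ?q = "\<lambda>r. measure lebesgue (A \<inter> sector_ball \<alpha> r) / measure lebesgue (sector_ball \<alpha> r)"
  have "?q r \<le> 1" for r
  proof -
    have "measure lebesgue (A \<inter> sector_ball \<alpha> r) \<le> measure lebesgue (sector_ball \<alpha> r)"
      using A by (intro measure_mono_fmeasurable) (auto simp: fmeasurableD)
    then show ?thesis by (intro divide_le_eq_1[THEN iffD2]) (use measure_nonneg order_le_less in metis)
  qed
  then show "sector_upper_density \<alpha> A \<le> 1"
    unfolding sector_upper_density_def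
    by (intro Limsup_bounded always_eventually allI) (simp add: one_ereal_def)
  show "1 \<le> sector_upper_density \<alpha> A"
  proof (rule ccontr)
    assume "\<not> ?thesis"
    then obtain c where c: "sector_upper_density \<alpha> A < ereal c" "ereal c < 1"
      using ereal_dense2 by (metis not_le)
    from c(1) have "\<forall>\<^sub>F r in at_top. ereal (?q r) < ereal c"
      unfolding sector_upper_density_def by (rule Limsup_lessD)
    then obtain R where R: "\<And>r. r \<ge> R \<Longrightarrow> ?q r < c" by (auto simp: eventually_at_top_linorder)
    have "0 < 1 - c" using c(2) by (simp add: one_ereal_def)
    then obtain r where r: "r > max R 0"
        "measure lebesgue (sector_ball \<alpha> r - A) \<le> (1 - c) * measure lebesgue (sector_ball \<alpha> r)"
      using ev by blast
    then have pos: "0 < measure lebesgue (sector_ball \<alpha> r)" by (intro measure_sector_ball_pos) auto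
    have "sector_ball \<alpha> r - A = sector_ball \<alpha> r - A \<inter> sector_ball \<alpha> r" by auto
    also have "measure lebesgue \<dots> =
        measure lebesgue (sector_ball \<alpha> r) - measure lebesgue (A \<inter> sector_ball \<alpha> r)"
      using A by (intro measurable_measure_Diff sector_ball_lmeasurable) (auto simp: fmeasurableD)
    finally have "measure lebesgue (sector_ball \<alpha> r - A) =
        measure lebesgue (sector_ball \<alpha> r) - measure lebesgue (A \<inter> sector_ball \<alpha> r)" .
    then have "c * measure lebesgue (sector_ball \<alpha> r) \<le> measure lebesgue (A \<inter> sector_ball \<alpha> r)"
      using r(2) by (simp add: algebra_simps)
    moreover have "?q r < c" using R r(1) by simp
    ultimately show False using pos by (simp add: field_simps)
  qed
qed

text \<open>In the ball of radius \<open>(m + 1) * a\<close> the uncovered part lies within a fixed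
  multiple of \<open>a\<close> from the origin, so its share of the area is of order
  \<open>1 / (m + 1)\<close> squared.\<close>

lemma sector_upper_density_eq_1_if_annuli:
  assumes A: "A \<in> sets lebesgue"
    and ev: "\<And>m. \<exists>a>m. \<forall>t\<in>sector \<alpha>. c * real a < norm t \<and> norm t < real (Suc m * a) \<longrightarrow> t \<in> A"
    and c: "c > 0"
  shows "sector_upper_density \<alpha> A = 1"
proof (rule sector_upper_density_eq_1I[OF A])
  fix \<epsilon> R :: real assume "0 < \<epsilon>"
  \<comment> \<open>The first bound forces the radius \<open>?b\<close> beyond \<open>R\<close>, the
    second makes the area ratio \<open>(2 * c / (m + 1))\<close> squared at most \<epsilon>.\<close>
  obtain m where m: "real m > max R (4 * c\<^sup>2 / \<epsilon>)"
    using reals_Archimedean2 by blast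
  obtain a where a: "a > m" and
    sub: "\<forall>t\<in>sector \<alpha>. c * real a < norm t \<and> norm t < real (Suc m * a) \<longrightarrow> t \<in> A"
    using ev by blast
  let ?b = "real (Suc m * a)"
  let ?\<mu> = "\<lambda>r. measure lebesgue (sector_ball \<alpha> r)"
  \<comment> \<open>The factor 2 leaves room for points of norm exactly \<open>c * a\<close>, as
    \<open>sector_ball\<close> is defined by a strict inequality.\<close>
  have "sector_ball \<alpha> ?b - A \<subseteq> sector_ball \<alpha> (2 * c * real a)"
  proof
    fix t assume t: "t \<in> sector_ball \<alpha> ?b - A"
    then have "norm t \<le> c * real a" using sub by (auto simp: sector_ball_def not_less)
    also have "\<dots> < 2 * c * real a" using c a by simp
    finally show "t \<in> sector_ball \<alpha> (2 * c * real a)" using t by (simp add: sector_ball_def)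
  qed
  then have "measure lebesgue (sector_ball \<alpha> ?b - A) \<le> ?\<mu> (2 * c * real a)"
    using A by (intro measure_mono_fmeasurable) (auto simp: fmeasurableD)
  also have "\<dots> = (2 * c * real a)\<^sup>2 * ?\<mu> 1"
    using a c by (intro measure_sector_ball) auto
  also have "\<dots> = (2 * c / real (Suc m))\<^sup>2 * (?b\<^sup>2 * ?\<mu> 1)"
  proof -
    have "2 * c * real a = 2 * c / real (Suc m) * ?b"
      by (simp only: of_nat_mult) (simp del: of_nat_Suc)
    then show ?thesis by (simp only: power_mult_distrib mult.assoc)
  qed
  also have "?b\<^sup>2 * ?\<mu> 1 = ?\<mu> ?b"
    using a by (intro measure_sector_ball[symmetric]) (simp only: of_nat_0_less_iff, simp)
  also have "(2 * c / real (Suc m))\<^sup>2 * ?\<mu> ?b \<le> \<epsilon> * ?\<mu> ?b"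
  proof (rule mult_right_mono)
    have "4 * c\<^sup>2 < \<epsilon> * real m" using m \<open>0 < \<epsilon>\<close> by (simp add: field_simps)
    also have "\<dots> \<le> \<epsilon> * (real (Suc m))\<^sup>2"
      using \<open>0 < \<epsilon>\<close> by (intro mult_left_mono) (auto simp: power2_eq_square algebra_simps)
    finally show "(2 * c / real (Suc m))\<^sup>2 \<le> \<epsilon>"
      by (simp add: power_divide power_mult_distrib divide_le_eq)
  qed simp
  finally have "measure lebesgue (sector_ball \<alpha> ?b - A) \<le> \<epsilon> * ?\<mu> ?b" .
  moreover have "?b > R"
  proof -
    have "m < Suc m * a" using a by (simp add: less_le_trans)
    then have "real m < ?b" by (rule of_nat_less_iff[THEN iffD2])
    then show ?thesis using m by linarith
  qed
  ultimately show "\<exists>r>R. measure lebesgue (sector_ball \<alpha> r - A) \<le> \<epsilon> * ?\<mu> r" by blast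
qed

text \<open>Inside the ball of radius \<open>n\<close> each shell of width 1 has area at most
  \<open>2 * n\<close> times that of the unit sector ball. At most \<open>\<epsilon> / 2 * n\<close>
  bad shells therefore take up no more than the fraction \<epsilon> of the ball.\<close>

lemma sector_upper_density_eq_1_if_nat:
  assumes A: "A \<in> sets lebesgue"
    and G: "\<And>t. t \<in> sector \<alpha> \<Longrightarrow> nat \<lfloor>norm t\<rfloor> \<in> G \<Longrightarrow> t \<in> A"
    and ev: "\<And>\<epsilon> N. 0 < \<epsilon> \<Longrightarrow> \<exists>n>N. real (card ({..<n} - G)) \<le> \<epsilon> * real n"
  shows "sector_upper_density \<alpha> A = 1"
proof (rule sector_upper_density_eq_1I[OF A])
  fix \<epsilon> R :: real assume "0 < \<epsilon>"
  then obtain n where n: "n > nat \<lceil>\<bar>R\<bar>\<rceil>" "real (card ({..<n} - G)) \<le> \<epsilon> / 2 * real n"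
    using ev[of "\<epsilon> / 2"] by auto
  let ?\<mu> = "\<lambda>r. measure lebesgue (sector_ball \<alpha> r)"
  let ?D = "\<lambda>k. sector_ball \<alpha> (real k + 1) - sector_ball \<alpha> (real k)"
  have nR: "real n > R" "n > 0" using n(1) by linarith+
  have D: "?D k \<in> lmeasurable" for k by (intro fmeasurable.Diff sector_ball_lmeasurable)
  have \<mu>D: "measure lebesgue (?D k) \<le> 2 * real n * ?\<mu> 1" if "k < n" for k
  proof -
    have "measure lebesgue (?D k) = ?\<mu> (real k + 1) - ?\<mu> (real k)"
      by (intro measurable_measure_Diff fmeasurableD sector_ball_lmeasurable) (auto simp: sector_ball_def)
    also have "?\<mu> (real k) = (real k)\<^sup>2 * ?\<mu> 1"
    proof (cases "k = 0")
      case True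
      have "sector_ball \<alpha> 0 = {}" by (auto simp: sector_ball_def not_less)
      then show ?thesis using True by simp
    qed (intro measure_sector_ball, simp)
    also have "?\<mu> (real k + 1) = (real k + 1)\<^sup>2 * ?\<mu> 1" by (intro measure_sector_ball) auto
    also have "(real k + 1)\<^sup>2 * ?\<mu> 1 - (real k)\<^sup>2 * ?\<mu> 1 = (2 * real k + 1) * ?\<mu> 1"
      by (simp add: algebra_simps power2_eq_square)
    also have "\<dots> \<le> 2 * real n * ?\<mu> 1" using that by (intro mult_right_mono) auto
    finally show ?thesis .
  qed
  have "sector_ball \<alpha> n - A \<subseteq> (\<Union>k\<in>{..<n} - G. ?D k)"
  proof
    fix t assume t: "t \<in> sector_ball \<alpha> n - A"
    then have "nat \<lfloor>norm t\<rfloor> \<notin> G" using G by (auto simp: sector_ball_def)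
    moreover have "nat \<lfloor>norm t\<rfloor> < n" using t by (auto simp: sector_ball_def nat_less_iff floor_less_iff)
    moreover have "t \<in> ?D (nat \<lfloor>norm t\<rfloor>)" using t by (auto simp: sector_ball_def not_less)
    ultimately show "t \<in> (\<Union>k\<in>{..<n} - G. ?D k)" by blast
  qed
  then have "measure lebesgue (sector_ball \<alpha> n - A) \<le> measure lebesgue (\<Union>k\<in>{..<n} - G. ?D k)"
    using A D by (intro measure_mono_fmeasurable fmeasurable.finite_UN) (auto simp: fmeasurableD)
  also have "\<dots> \<le> (\<Sum>k\<in>{..<n} - G. measure lebesgue (?D k))"
    using D by (intro measure_UNION_le) (auto simp: fmeasurableD)
  also have "\<dots> \<le> (\<Sum>k\<in>{..<n} - G. 2 * real n * ?\<mu> 1)" by (intro sum_mono \<mu>D) auto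
  also have "\<dots> = real (card ({..<n} - G)) * (2 * real n * ?\<mu> 1)" by simp
  also have "\<dots> \<le> (\<epsilon> / 2 * real n) * (2 * real n * ?\<mu> 1)" using n(2) by (intro mult_right_mono) auto
  also have "\<dots> = \<epsilon> * ((real n)\<^sup>2 * ?\<mu> 1)" by (simp add: power2_eq_square)
  also have "(real n)\<^sup>2 * ?\<mu> 1 = ?\<mu> n" using nR by (intro measure_sector_ball[symmetric]) auto
  finally show "\<exists>r>R. measure lebesgue (sector_ball \<alpha> r - A) \<le> \<epsilon> * ?\<mu> r" using nR by blast
qed

end

subsection \<open>Translations of weighted Lebesgue spaces\<close>

lemma measurable_shift_lebesgue: "(\<lambda>s. s + t) \<in> lebesgue \<rightarrow>\<^sub>M lebesgue" for t :: "'a::euclidean_space"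
proof (rule measurableI)
  fix A :: "'a set" assume A: "A \<in> sets lebesgue"
  have "(\<lambda>s. s + t) -` A = (\<lambda>x. - t + x) ` A"
    by (auto simp: image_iff) (metis add.commute add_diff_cancel_right' uminus_add_conv_diff)
  then show "(\<lambda>s. s + t) -` A \<inter> space lebesgue \<in> sets lebesgue"
    using lebesgue_sets_translation[OF A, of "- t"] by simp
qed auto

lemma distr_shift_lebesgue: "distr lebesgue lebesgue (\<lambda>s. s + t) = lebesgue" for t :: "'a::euclidean_space"
proof (rule measure_eqI)
  fix A :: "'a set" assume "A \<in> sets (distr lebesgue lebesgue (\<lambda>s. s + t))"
  then have A: "A \<in> sets lebesgue" by simp
  have "(\<lambda>s. s + t) -` A = (\<lambda>x. 1 *\<^sub>R x + (- t)) ` A"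
    by (auto simp: image_iff) (metis add_diff_cancel_right')
  then show "emeasure (distr lebesgue lebesgue (\<lambda>s. s + t)) A = emeasure lebesgue A"
    using A emeasure_lebesgue_affine[of 1 "- t" A]
    by (simp add: emeasure_distr measurable_shift_lebesgue)
qed simp

lemma nn_integral_shift_lebesgue:
  fixes t :: "'a::euclidean_space"
  assumes "f \<in> borel_measurable lebesgue"
  shows "(\<integral>\<^sup>+s. f (s + t) \<partial>lebesgue) = (\<integral>\<^sup>+s. f s \<partial>lebesgue)"
  using nn_integral_distr[OF measurable_shift_lebesgue[of t], of f] assms
  by (simp add: distr_shift_lebesgue)

lemma AE_shift_lebesgue:
  fixes t :: "'a::euclidean_space"
  assumes "AE s in lebesgue. P s"
  shows "AE s in lebesgue. P (s + t)"
proof -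
  obtain N where N: "N \<in> null_sets lebesgue" "{s. \<not> P s} \<subseteq> N"
    using assms by (auto simp: eventually_ae_filter)
  have "{s. \<not> P (s + t)} \<subseteq> (+) (- t) ` N"
  proof
    fix s assume "s \<in> {s. \<not> P (s + t)}"
    then have "s + t \<in> N" using N by auto
    then show "s \<in> (+) (- t) ` N" by (rule rev_image_eqI) simp
  qed
  moreover have "(+) (- t) ` N \<in> null_sets lebesgue"
    using N negligible_translation[of N "- t"] by (simp add: negligible_iff_null_sets)
  ultimately show ?thesis by (auto simp: eventually_ae_filter)
qed

text \<open>A crude substitute for Minkowski's inequality: the norm of a sum is at most twice the
  larger norm. The constant is harmless and allows working with p-th powers throughout.\<close>

lemma powr_norm_add_le:
  fixes x y :: "'a::real_normed_vector"
  assumes "1 \<le> p"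
  shows "norm (x + y) powr p \<le> 2 powr p * (norm x powr p + norm y powr p)"
proof -
  let ?m = "max (norm x) (norm y)"
  have "norm (x + y) powr p \<le> (2 * ?m) powr p"
    using norm_triangle_ineq[of x y] assms by (intro powr_mono2) auto
  also have "\<dots> = 2 powr p * ?m powr p" by (simp add: powr_mult)
  also have "?m powr p \<le> norm x powr p + norm y powr p" by (auto simp: max_def)
  finally show ?thesis by simp
qed

lemma powr_less_powr_iff: "0 \<le> x \<Longrightarrow> 0 \<le> y \<Longrightarrow> 0 < p \<Longrightarrow> x powr p < y powr p \<longleftrightarrow> x < y" for x y p :: real
  by (metis less_imp_le not_le powr_less_mono2 powr_mono2)

locale weighted_sector = proper_sector +
  fixes p :: real and v :: "complex \<Rightarrow> real"
  assumes p_ge_1: "1 \<le> p" and admissible: "admissible_weight \<alpha> v"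
begin

abbreviation L :: "complex measure" where "L \<equiv> lebesgue_on (sector \<alpha>)"

text \<open>The p-th power of the norm as an extended nonnegative integral, so that it can be
  estimated before integrability is known. Estimates are made for it and turned into distances only
  at the end.\<close>

definition Lp_energy :: "(complex \<Rightarrow> 'a::real_normed_vector) \<Rightarrow> ennreal" where
  "Lp_energy f = (\<integral>\<^sup>+s. ennreal (norm (f s) powr p * v s) \<partial>L)"

lemma v_measurable [measurable]: "v \<in> borel_measurable L"
  using admissible by (simp add: admissible_weight_def)

lemma v_pos: "t \<in> sector \<alpha> \<Longrightarrow> 0 < v t"
  using admissible by (simp add: admissible_weight_def)

lemma v_shift:
  obtains M w where "1 \<le> M"
    "\<And>t t'. t \<in> sector \<alpha> \<Longrightarrow> t' \<in> sector \<alpha> \<Longrightarrow> v t \<le> M * exp (w * norm t') * v (t + t')"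
  using admissible unfolding admissible_weight_def by blast

lemma AE_L_iff: "(AE s in L. P s) \<longleftrightarrow> (AE s in lebesgue. s \<in> sector \<alpha> \<longrightarrow> P s)"
  by (rule AE_restrict_space_iff) simp

lemma nn_integral_L: "(\<integral>\<^sup>+s. f s \<partial>L) = (\<integral>\<^sup>+s. f s * indicator (sector \<alpha>) s \<partial>lebesgue)"
  by (rule nn_integral_restrict_space) simp

text \<open>Null sets are shift invariant, and \<open>s + t\<close> stays in the sector. This makes
  translation independent of the chosen representative.\<close>

lemma AE_L_shift:
  assumes "t \<in> sector \<alpha>" "AE s in L. P s"
  shows "AE s in L. P (s + t)"
proof -
  have "AE s in lebesgue. s + t \<in> sector \<alpha> \<longrightarrow> P (s + t)"
    using assms(2) unfolding AE_L_iff by (rule AE_shift_lebesgue)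
  then show ?thesis
    unfolding AE_L_iff by eventually_elim (use assms(1) sector_add in blast)
qed

lemma measurable_shift_L:
  assumes "f \<in> borel_measurable L" "t \<in> sector \<alpha>"
  shows "(\<lambda>s. f (s + t)) \<in> borel_measurable L"
proof (rule measurable_compose[OF _ assms(1)])
  show "(\<lambda>s. s + t) \<in> L \<rightarrow>\<^sub>M L"
    using assms(2) sector_add
    by (intro measurable_restrict_space2 measurable_restrict_space1 measurable_shift_lebesgue)
      (auto simp: space_restrict_space)
qed

section \<open>From equivalence classes to representatives\<close>

lemma class_rep_ae_class:
  assumes "f \<in> borel_measurable L"
  shows "class_rep (ae_class \<alpha> f) \<in> borel_measurable L"
    and "AE s in L. class_rep (ae_class \<alpha> f) s = f s"
proof -
  have "f \<in> ae_class \<alpha> f" using assms by (simp add: ae_class_def)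
  then have "class_rep (ae_class \<alpha> f) \<in> ae_class \<alpha> f" unfolding class_rep_def
    by (rule someI[of "\<lambda>g. g \<in> ae_class \<alpha> f"])
  then show "class_rep (ae_class \<alpha> f) \<in> borel_measurable L"
    and "AE s in L. class_rep (ae_class \<alpha> f) s = f s" by (auto simp: ae_class_def)
qed

lemma ae_class_cong: "AE s in L. f s = g s \<Longrightarrow> ae_class \<alpha> f = ae_class \<alpha> g"
  unfolding ae_class_def by (auto elim: AE_mp)

lemma translation_ae_class:
  assumes "f \<in> borel_measurable L" "t \<in> sector \<alpha>"
  shows "translation \<alpha> t (ae_class \<alpha> f) = ae_class \<alpha> (\<lambda>s. f (s + t))"
  unfolding translation_def
  by (intro ae_class_cong AE_L_shift[where P = "\<lambda>s. class_rep (ae_class \<alpha> f) s = f s"]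
      assms class_rep_ae_class)

lemma Lp_energy_cong_AE: "AE s in L. f s = g s \<Longrightarrow> Lp_energy f = Lp_energy g"
  unfolding Lp_energy_def by (intro nn_integral_cong_AE) auto

lemma integrand_measurable [measurable]:
  fixes f :: "complex \<Rightarrow> 'a::euclidean_space"
  assumes [measurable]: "f \<in> borel_measurable L"
  shows "(\<lambda>s. norm (f s) powr p * v s) \<in> borel_measurable L"
  by measurable

lemma integrand_nonneg: "s \<in> sector \<alpha> \<Longrightarrow> 0 \<le> norm (f s) powr p * v s"
  using v_pos by (simp add: less_imp_le)

lemma Lp_seminorm_eq:
  fixes f :: "complex \<Rightarrow> 'a::euclidean_space"
  assumes [measurable]: "f \<in> borel_measurable L"
  shows "Lp_seminorm \<alpha> p v f = enn2real (Lp_energy f) powr (1 / p)"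
  unfolding Lp_seminorm_def Lp_energy_def
  by (subst integral_eq_nn_integral) (auto simp: space_restrict_space integrand_nonneg intro!: AE_I2)

lemma Lp_fun_iff:
  fixes f :: "complex \<Rightarrow> 'a::euclidean_space"
  shows "f \<in> Lp_fun \<alpha> p v \<longleftrightarrow> f \<in> borel_measurable L \<and> Lp_energy f < \<infinity>"
proof -
  have "(\<integral>\<^sup>+s. ennreal (norm (norm (f s) powr p * v s)) \<partial>L) = Lp_energy f"
    unfolding Lp_energy_def
    by (intro nn_integral_cong) (simp add: space_restrict_space abs_of_nonneg[OF integrand_nonneg])
  then show ?thesis unfolding Lp_fun_def by (auto simp: integrable_iff_bounded)
qed

lemma Lp_dist_ae_class:
  fixes f g :: "complex \<Rightarrow> 'a::euclidean_space"
  assumes f: "f \<in> borel_measurable L" and g: "g \<in> borel_measurable L"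
  shows "Lp_dist \<alpha> p v (ae_class \<alpha> f) (ae_class \<alpha> g) = enn2real (Lp_energy (\<lambda>s. f s - g s)) powr (1 / p)"
proof -
  let ?d = "\<lambda>s. class_rep (ae_class \<alpha> f) s - class_rep (ae_class \<alpha> g) s"
  have d: "?d \<in> borel_measurable L"
    using class_rep_ae_class(1)[OF f] class_rep_ae_class(1)[OF g] by (rule borel_measurable_diff)
  have "AE s in L. ?d s = f s - g s"
    using class_rep_ae_class(2)[OF f] class_rep_ae_class(2)[OF g] by eventually_elim simp
  then have eq: "Lp_energy ?d = Lp_energy (\<lambda>s. f s - g s)" by (rule Lp_energy_cong_AE)
  show ?thesis
    unfolding Lp_dist_def class_diff_def Lp_norm_def Lp_seminorm_eq[OF class_rep_ae_class(1)[OF d]]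
      Lp_energy_cong_AE[OF class_rep_ae_class(2)[OF d]] eq ..
qed

lemma Lp_dist_translation:
  fixes f g :: "complex \<Rightarrow> 'a::euclidean_space"
  assumes f: "f \<in> borel_measurable L" and g: "g \<in> borel_measurable L" and t: "t \<in> sector \<alpha>"
  shows "Lp_dist \<alpha> p v (translation \<alpha> t (ae_class \<alpha> f)) (translation \<alpha> t (ae_class \<alpha> g)) =
    enn2real (Lp_energy (\<lambda>s. f (s + t) - g (s + t))) powr (1 / p)"
  unfolding translation_ae_class[OF f t] translation_ae_class[OF g t]
  by (intro Lp_dist_ae_class measurable_shift_L f g t)

text \<open>Monotonicity of the p-th power. Finiteness of \<open>E\<close> matters, because
  \<open>enn2real\<close> sends infinity to 0.\<close>

lemma root_less_iff:
  assumes "E < \<infinity>" "0 < \<epsilon>"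
  shows "enn2real E powr (1 / p) < \<epsilon> \<longleftrightarrow> E < ennreal (\<epsilon> powr p)"
proof -
  have "enn2real E powr (1 / p) < \<epsilon> \<longleftrightarrow> (enn2real E powr (1 / p)) powr p < \<epsilon> powr p"
    using p_ge_1 assms by (subst powr_less_powr_iff) auto
  also have "(enn2real E powr (1 / p)) powr p = enn2real E" using p_ge_1 by (simp add: powr_powr)
  also have "enn2real E < \<epsilon> powr p \<longleftrightarrow> E < ennreal (\<epsilon> powr p)"
    using assms by (cases E) (auto simp: ennreal_less_iff)
  finally show ?thesis .
qed

lemma root_greater_iff:
  assumes "E < \<infinity>" "0 < \<epsilon>"
  shows "\<epsilon> < enn2real E powr (1 / p) \<longleftrightarrow> ennreal (\<epsilon> powr p) < E"
proof -
  have "\<epsilon> < enn2real E powr (1 / p) \<longleftrightarrow> \<epsilon> powr p < (enn2real E powr (1 / p)) powr p"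
    using p_ge_1 assms by (subst powr_less_powr_iff) auto
  also have "(enn2real E powr (1 / p)) powr p = enn2real E" using p_ge_1 by (simp add: powr_powr)
  also have "\<epsilon> powr p < enn2real E \<longleftrightarrow> ennreal (\<epsilon> powr p) < E"
    using assms by (cases E) (auto simp: ennreal_less_iff)
  finally show ?thesis .
qed

text \<open>The weight at \<open>s\<close> is traded for the weight at \<open>s + t\<close>; then
  \<open>s + t\<close> is the new variable of integration. It runs over a part of the sector, and
  integrating over all of it can only enlarge the value.\<close>

lemma Lp_energy_shift_le:
  fixes f :: "complex \<Rightarrow> 'a::euclidean_space"
  assumes f: "f \<in> borel_measurable L" and t: "t \<in> sector \<alpha>"
    and c: "0 \<le> c" "\<And>s. s \<in> sector \<alpha> \<Longrightarrow> v s \<le> c * v (s + t)"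
  shows "Lp_energy (\<lambda>s. f (s + t)) \<le> ennreal c * Lp_energy f"
proof -
  \<comment> \<open>Extension by zero to the whole plane, where the integral is shift
    invariant.\<close>
  let ?F = "\<lambda>s. ennreal (norm (f s) powr p * v s) * indicator (sector \<alpha>) s"
  have F: "?F \<in> borel_measurable lebesgue"
    using integrand_measurable[OF f]
    by (subst borel_measurable_restrict_space_iff_ennreal[symmetric]) (auto intro: sector_lebesgue)
  have "Lp_energy (\<lambda>s. f (s + t)) =
      (\<integral>\<^sup>+s. ennreal (norm (f (s + t)) powr p * v s) * indicator (sector \<alpha>) s \<partial>lebesgue)"
    unfolding Lp_energy_def by (rule nn_integral_L)
  also have "\<dots> \<le> (\<integral>\<^sup>+s. ennreal c * ?F (s + t) \<partial>lebesgue)"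
  proof (rule nn_integral_mono)
    fix s :: complex
    show "ennreal (norm (f (s + t)) powr p * v s) * indicator (sector \<alpha>) s \<le> ennreal c * ?F (s + t)"
    proof (cases "s \<in> sector \<alpha>")
      case True
      have "norm (f (s + t)) powr p * v s \<le> norm (f (s + t)) powr p * (c * v (s + t))"
        using c(2)[OF True] by (intro mult_left_mono) auto
      then show ?thesis using True sector_add[OF True t] c(1)
        by (simp add: ennreal_mult'[symmetric] ennreal_leI mult.left_commute)
    qed simp
  qed
  also have "\<dots> = ennreal c * (\<integral>\<^sup>+s. ?F (s + t) \<partial>lebesgue)"
    using measurable_compose[OF measurable_shift_lebesgue F] by (rule nn_integral_cmult)
  also have "(\<integral>\<^sup>+s. ?F (s + t) \<partial>lebesgue) = Lp_energy f"
    unfolding nn_integral_shift_lebesgue[OF F] Lp_energy_def nn_integral_L ..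
  finally show ?thesis .
qed

lemma Lp_energy_shift_finite:
  fixes f :: "complex \<Rightarrow> 'a::euclidean_space"
  assumes f: "f \<in> borel_measurable L" "Lp_energy f < \<infinity>" and t: "t \<in> sector \<alpha>"
  shows "Lp_energy (\<lambda>s. f (s + t)) < \<infinity>"
proof -
  obtain M w where "1 \<le> M"
    "\<And>t t'. t \<in> sector \<alpha> \<Longrightarrow> t' \<in> sector \<alpha> \<Longrightarrow> v t \<le> M * exp (w * norm t') * v (t + t')"
    using v_shift by blast
  then have "Lp_energy (\<lambda>s. f (s + t)) \<le> ennreal (M * exp (w * norm t)) * Lp_energy f"
    using t by (intro Lp_energy_shift_le f) auto
  also have "\<dots> < \<infinity>" using f(2) by (simp add: ennreal_mult_less_top)
  finally show ?thesis .
qed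

lemma Lp_energy_add_le:
  fixes f g :: "complex \<Rightarrow> 'a::euclidean_space"
  assumes [measurable]: "f \<in> borel_measurable L" "g \<in> borel_measurable L"
  shows "Lp_energy (\<lambda>s. f s + g s) \<le> ennreal (2 powr p) * (Lp_energy f + Lp_energy g)"
proof -
  have "Lp_energy (\<lambda>s. f s + g s) \<le>
      (\<integral>\<^sup>+s. ennreal (2 powr p) * (ennreal (norm (f s) powr p * v s) + ennreal (norm (g s) powr p * v s)) \<partial>L)"
    unfolding Lp_energy_def
  proof (rule nn_integral_mono)
    fix s assume "s \<in> space L"
    then have s: "s \<in> sector \<alpha>" by (simp add: space_restrict_space)
    have "norm (f s + g s) powr p * v s \<le> 2 powr p * (norm (f s) powr p + norm (g s) powr p) * v s"
      using v_pos[OF s] by (intro mult_right_mono powr_norm_add_le p_ge_1) auto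
    also have "\<dots> = 2 powr p * (norm (f s) powr p * v s + norm (g s) powr p * v s)"
      by (simp add: algebra_simps)
    finally have "ennreal (norm (f s + g s) powr p * v s)
        \<le> ennreal (2 powr p * (norm (f s) powr p * v s + norm (g s) powr p * v s))"
      by (rule ennreal_leI)
    then show "ennreal (norm (f s + g s) powr p * v s) \<le>
        ennreal (2 powr p) * (ennreal (norm (f s) powr p * v s) + ennreal (norm (g s) powr p * v s))"
      using integrand_nonneg[OF s, of f] integrand_nonneg[OF s, of g] by (simp add: ennreal_mult)
  qed
  also have "\<dots> = ennreal (2 powr p) * (Lp_energy f + Lp_energy g)"
    unfolding Lp_energy_def by (subst nn_integral_cmult, measurable, subst nn_integral_add, measurable)
  finally show ?thesis .
qed

lemma Lp_energy_scaleR: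
  fixes f :: "complex \<Rightarrow> 'a::euclidean_space"
  assumes [measurable]: "f \<in> borel_measurable L"
  shows "Lp_energy (\<lambda>s. c *\<^sub>R f s) = ennreal (\<bar>c\<bar> powr p) * Lp_energy f"
proof -
  have "Lp_energy (\<lambda>s. c *\<^sub>R f s) = (\<integral>\<^sup>+s. ennreal (\<bar>c\<bar> powr p) * ennreal (norm (f s) powr p * v s) \<partial>L)"
    unfolding Lp_energy_def by (simp add: powr_mult ennreal_mult'[symmetric] mult.assoc)
  also have "\<dots> = ennreal (\<bar>c\<bar> powr p) * Lp_energy f"
    unfolding Lp_energy_def by (rule nn_integral_cmult) measurable
  finally show ?thesis .
qed

section \<open>Local bounds on the weight and energies of bounded functions with bounded
  support\<close>

lemma v_bounded_on_bounded:
  obtains B where "\<And>t. t \<in> sector \<alpha> \<Longrightarrow> norm t \<le> R \<Longrightarrow> v t \<le> B"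
proof -
  obtain M w where M: "1 \<le> M" and
    vM: "\<And>t t'. t \<in> sector \<alpha> \<Longrightarrow> t' \<in> sector \<alpha> \<Longrightarrow> v t \<le> M * exp (w * norm t') * v (t + t')"
    using v_shift by blast
  \<comment> \<open>The point \<open>x\<close> lies in \<open>t + sector \<alpha>\<close> for every \<open>t\<close> of norm at most \<open>R\<close>.\<close>
  define x where "x = R + R / tan \<alpha>"
  \<comment> \<open>Admissibility with \<open>t' = x - t\<close> bounds \<open>v t\<close> by a
    multiple of the single value of \<open>v\<close> at \<open>x\<close>; the norm of
    \<open>t'\<close> is at most \<open>\<bar>x\<bar> + R\<close>.\<close>
  have "v t \<le> M * exp (\<bar>w\<bar> * (\<bar>x\<bar> + R)) * v (of_real x)" if t: "t \<in> sector \<alpha>" "norm t \<le> R" for t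
  proof -
    have R: "0 \<le> R" using t(2) norm_ge_zero[of t] by linarith
    have "\<bar>Im t\<bar> \<le> R" "Re t \<le> R"
      using abs_Im_le_cmod[of t] complex_Re_le_cmod[of t] t(2) by linarith+
    moreover from this have "R \<le> tan \<alpha> * (x - Re t)"
      using mult_nonneg_nonneg[of "tan \<alpha>" "R - Re t"] tan_\<alpha>_pos unfolding x_def by (simp add: algebra_simps)
    ultimately have xt: "of_real x - t \<in> sector \<alpha>" by (simp add: sector_iff)
    have x: "of_real x \<in> sector \<alpha>" using R tan_\<alpha>_pos by (simp add: sector_iff x_def)
    have "norm (of_real x - t) \<le> \<bar>x\<bar> + R" using norm_triangle_ineq4[of "of_real x" t] t(2) by simp
    then have "w * norm (of_real x - t) \<le> \<bar>w\<bar> * (\<bar>x\<bar> + R)"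
      by (intro mult_mono) auto
    then have "M * exp (w * norm (of_real x - t)) * v (of_real x) \<le> M * exp (\<bar>w\<bar> * (\<bar>x\<bar> + R)) * v (of_real x)"
      using M v_pos[OF x] by (intro mult_right_mono mult_left_mono) auto
    then show ?thesis using vM[OF t(1) xt] by simp
  qed
  then show ?thesis by (rule that)
qed

lemma v_integrable_on_ball: "(\<integral>\<^sup>+s. ennreal (v s) * indicator (cball 0 R) s \<partial>L) < \<infinity>"
proof -
  obtain B where B: "\<And>t. t \<in> sector \<alpha> \<Longrightarrow> norm t \<le> R \<Longrightarrow> v t \<le> B"
    using v_bounded_on_bounded by blast
  have "(\<integral>\<^sup>+s. ennreal (v s) * indicator (cball 0 R) s \<partial>L) \<le> (\<integral>\<^sup>+s. ennreal B * indicator (cball 0 R) (s :: complex) \<partial>lebesgue)"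
    unfolding nn_integral_L
    by (intro nn_integral_mono) (auto simp: indicator_def intro!: ennreal_leI B)
  also have "\<dots> = ennreal B * emeasure lebesgue (cball 0 R :: complex set)"
    by (rule nn_integral_cmult_indicator) simp
  also have "\<dots> < \<infinity>"
    using emeasure_bounded_finite[of "cball 0 R :: complex set"] by (simp add: ennreal_mult_less_top)
  finally show ?thesis .
qed

lemma Lp_energy_finite_if_bounded:
  fixes f :: "complex \<Rightarrow> 'a::euclidean_space"
  assumes B: "\<And>s. norm (f s) \<le> B" and R: "\<And>s. norm s > R \<Longrightarrow> f s = 0"
  shows "Lp_energy f < \<infinity>"
proof -
  have "Lp_energy f \<le> (\<integral>\<^sup>+s. ennreal (B powr p) * (ennreal (v s) * indicator (cball 0 R) s) \<partial>L)"
    unfolding Lp_energy_def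
  proof (rule nn_integral_mono)
    fix s assume "s \<in> space L"
    then have s: "s \<in> sector \<alpha>" by (simp add: space_restrict_space)
    have "norm (f s) powr p * v s \<le> B powr p * v s"
      using v_pos[OF s] B p_ge_1 by (intro mult_right_mono powr_mono2) auto
    then show "ennreal (norm (f s) powr p * v s) \<le> ennreal (B powr p) * (ennreal (v s) * indicator (cball 0 R) s)"
      using R[of s] by (cases "norm s > R") (auto simp: ennreal_mult'[symmetric] intro: ennreal_leI)
  qed
  also have "\<dots> = ennreal (B powr p) * (\<integral>\<^sup>+s. ennreal (v s) * indicator (cball 0 R) s \<partial>L)"
  proof (rule nn_integral_cmult)
    have [measurable]: "(\<lambda>s. indicator (cball 0 R) s :: ennreal) \<in> borel_measurable L"
      by (intro measurable_restrict_space1 borel_measurable_indicator) auto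
    show "(\<lambda>s. ennreal (v s) * indicator (cball 0 R) s) \<in> borel_measurable L" by measurable
  qed
  also have "\<dots> < \<infinity>" using v_integrable_on_ball by (simp add: ennreal_mult_less_top)
  finally show ?thesis .
qed

end

subsection \<open>Approximation by continuous functions\<close>

text \<open>Provides labels from which the coefficients \<rho> are formed. Since they lie in a
  half-open unit interval, adding an integer to a label loses no information.\<close>

lemma continuous_functions_inj_unit_interval:
  obtains \<phi> :: "('a::second_countable_topology \<Rightarrow> 'b::{second_countable_topology, t2_space}) \<Rightarrow> real"
  where "inj_on \<phi> {g. continuous_on UNIV g}" "\<And>g. 0 \<le> \<phi> g" "\<And>g. \<phi> g < 1"
proof -
  obtain D :: "'a set" where D: "countable D" "\<And>X. open X \<Longrightarrow> X \<noteq> {} \<Longrightarrow> \<exists>d\<in>D. d \<in> X"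
    by (rule countable_dense_setE) blast
  obtain B :: "'b set set" where B: "countable B" "topological_basis B"
    using ex_countable_basis by blast
  \<comment> \<open>A continuous function is determined by which basic open sets contain its values on \<open>D\<close>.\<close>
  define code where "code g = to_nat_on (D \<times> B) ` {(q, U) \<in> D \<times> B. g q \<in> U}" for g :: "'a \<Rightarrow> 'b"
  have inj: "inj_on code {g. continuous_on UNIV g}"
  proof (rule inj_onI, rule ccontr)
    fix f g :: "'a \<Rightarrow> 'b"
    assume fg: "f \<in> {g. continuous_on UNIV g}" "g \<in> {g. continuous_on UNIV g}"
      "code f = code g" "f \<noteq> g"
    from fg(3) have eq: "{(q, U) \<in> D \<times> B. f q \<in> U} = {(q, U) \<in> D \<times> B. g q \<in> U}"
      unfolding code_def
      by (subst (asm) inj_on_image_eq_iff[where C = "D \<times> B"]) (auto simp: D B inj_on_to_nat_on)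
    \<comment> \<open>Continuous maps into a Hausdorff space differ on an open set, so two different
      ones already differ at a point of the dense set \<open>D\<close>.\<close>
    have "open (- {x. f x = g x})"
      using fg by (intro open_Compl closed_Collect_eq) auto
    moreover have "- {x. f x = g x} \<noteq> {}" using fg(4) by auto
    ultimately obtain d where d: "d \<in> D" "f d \<noteq> g d" using D(2) by fastforce
    then obtain U where "open U" "f d \<in> U" "g d \<notin> U"
      using t1_space by metis
    then obtain U' where U': "U' \<in> B" "f d \<in> U'" "g d \<notin> U'"
      by (meson topological_basisE[OF B(2)] subsetD)
    then have "(d, U') \<in> {(q, U) \<in> D \<times> B. f q \<in> U}" using d by simp
    with U' show False unfolding eq by simp
  qed
  obtain \<psi> :: "nat set \<Rightarrow> real" where \<psi>: "inj \<psi>" "range \<psi> \<subseteq> {0..<1}"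
    using nat_sets_lepoll_reals01 unfolding lepoll_def by auto
  show ?thesis
  proof (rule that[of "\<psi> \<circ> code"])
    show "inj_on (\<psi> \<circ> code) {g. continuous_on UNIV g}"
      using inj \<psi>(1) by (auto intro!: comp_inj_on inj_on_subset[of \<psi> UNIV])
  qed (use \<psi>(2) in \<open>auto simp: image_subset_iff\<close>)
qed

text \<open>In the plane these are exactly the continuous functions of compact support; the radius
  is what makes their shifts by large \<open>t\<close> vanish on the sector.\<close>

definition continuous_bounded_support :: "(complex \<Rightarrow> 'a::euclidean_space) set" where
  "continuous_bounded_support = {g. continuous_on UNIV g \<and> (\<exists>R. \<forall>s. norm s > R \<longrightarrow> g s = 0)}"

context weighted_sector
begin

lemma borel_measurable_L: "f \<in> borel_measurable borel \<Longrightarrow> f \<in> borel_measurable L"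
  by (intro measurable_restrict_space1 measurable_completion) simp

lemma continuous_bounded_support_borel:
  "g \<in> continuous_bounded_support \<Longrightarrow> g \<in> borel_measurable borel"
  unfolding continuous_bounded_support_def by (simp add: borel_measurable_continuous_onI)

lemma continuous_bounded_support_energy_finite:
  assumes "g \<in> continuous_bounded_support"
  shows "Lp_energy g < \<infinity>"
proof -
  obtain R where R: "\<And>s. norm s > R \<Longrightarrow> g s = 0" and cont: "continuous_on UNIV g"
    using assms unfolding continuous_bounded_support_def by blast
  have "compact (g ` cball 0 R)"
    by (intro compact_continuous_image continuous_on_subset[OF cont]) auto
  then obtain B where B: "\<And>s. s \<in> cball 0 R \<Longrightarrow> norm (g s) \<le> B"
    using compact_imp_bounded bounded_iff by (metis imageI)
  have "norm (g s) \<le> max B 0" for s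
    using B[of s] R[of s] by (cases "norm s > R") (auto simp: le_max_iff_disj)
  then show ?thesis using R by (rule Lp_energy_finite_if_bounded)
qed

lemma Lp_energy_tendsto_0:
  fixes g :: "nat \<Rightarrow> complex \<Rightarrow> 'a::euclidean_space"
  assumes g: "\<And>n. g n \<in> borel_measurable L" and W: "W \<in> borel_measurable L" "(\<integral>\<^sup>+s. W s \<partial>L) < \<infinity>"
    and dom: "\<And>n s. s \<in> sector \<alpha> \<Longrightarrow> ennreal (norm (g n s) powr p * v s) \<le> W s"
    and lim: "AE s in L. (\<lambda>n. g n s) \<longlonglongrightarrow> 0"
  shows "(\<lambda>n. Lp_energy (g n)) \<longlonglongrightarrow> 0"
proof -
  have "(\<lambda>n. Lp_energy (g n)) \<longlonglongrightarrow> (\<integral>\<^sup>+s. 0 \<partial>L)"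
    unfolding Lp_energy_def
  proof (rule nn_integral_dominated_convergence)
    show "AE s in L. (\<lambda>n. ennreal (norm (g n s) powr p * v s)) \<longlonglongrightarrow> 0"
      using lim
    proof eventually_elim
      case (elim s)
      then have "(\<lambda>n. norm (g n s)) \<longlonglongrightarrow> 0" by (rule tendsto_norm_zero)
      then have "(\<lambda>n. norm (g n s) powr p) \<longlonglongrightarrow> 0 powr p"
        using p_ge_1 by (intro tendsto_powr') auto
      then have "(\<lambda>n. norm (g n s) powr p * v s) \<longlonglongrightarrow> 0 powr p * v s"
        by (rule tendsto_mult_right)
      then have "(\<lambda>n. ennreal (norm (g n s) powr p * v s)) \<longlonglongrightarrow> ennreal (0 powr p * v s)"
        by (rule tendsto_ennrealI)
      moreover have "ennreal (0 powr p * v s) = 0" by simp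
      ultimately show ?case by (simp only:)
    qed
    show "AE s in L. ennreal (norm (g n s) powr p * v s) \<le> W s" for n
      by (intro AE_I2 dom) (simp add: space_restrict_space)
  qed (use g W in auto)
  then show ?thesis by simp
qed

text \<open>At each point the truncation is exact as soon as \<open>N\<close> exceeds both the norm
  of the point and that of the value, and the error is dominated by \<open>f\<close> itself.\<close>

lemma Lp_energy_truncate:
  fixes f :: "complex \<Rightarrow> 'a::euclidean_space"
  assumes f: "f \<in> borel_measurable L" "Lp_energy f < \<infinity>" and "0 < e"
  obtains N :: nat where "0 < N"
    "Lp_energy (\<lambda>s. f s - (if norm s \<le> N \<and> norm (f s) \<le> N then f s else 0)) < e"
proof -
  have [measurable]: "f \<in> borel_measurable L" by fact
  have [measurable]: "(\<lambda>s. s) \<in> borel_measurable L" by (rule borel_measurable_L) simp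
  let ?g = "\<lambda>N s. f s - (if norm s \<le> real N \<and> norm (f s) \<le> real N then f s else 0)"
  have "(\<lambda>N. Lp_energy (?g N)) \<longlonglongrightarrow> 0"
  proof (rule Lp_energy_tendsto_0)
    show "(\<integral>\<^sup>+s. ennreal (norm (f s) powr p * v s) \<partial>L) < \<infinity>"
      using f(2) by (simp add: Lp_energy_def)
    show "?g N \<in> borel_measurable L" for N by measurable
    show "ennreal (norm (?g N s) powr p * v s) \<le> ennreal (norm (f s) powr p * v s)"
      if "s \<in> sector \<alpha>" for N s
      using that integrand_nonneg[OF that, of f] p_ge_1 by auto
    have "(\<lambda>N. ?g N s) \<longlonglongrightarrow> 0" for s
    proof (rule tendsto_eventually)
      show "\<forall>\<^sub>F N in sequentially. ?g N s = 0"
        using eventually_ge_at_top[of "nat \<lceil>max (norm s) (norm (f s))\<rceil>"]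
        by eventually_elim (auto simp: nat_le_iff ceiling_le_iff)
    qed
    then show "AE s in L. (\<lambda>N. ?g N s) \<longlonglongrightarrow> 0" by simp
  qed measurable
  then have "\<forall>\<^sub>F N in sequentially. Lp_energy (?g N) < e \<and> 0 < N"
    using \<open>0 < e\<close> by (intro eventually_conj order_tendstoD(2) eventually_gt_at_top)
  then obtain N where "Lp_energy (?g N) < e" "0 < N" using eventually_happens' sequentially_bot by blast
  then show ?thesis using that by blast
qed

text \<open>A measurable function is an almost everywhere limit of continuous ones. Clipping their
  values and cutting off their supports keeps continuity and bounds the error by
  \<open>2 * N\<close> on a ball, where the weight is integrable; dominated convergence then
  applies.\<close>

lemma bounded_approx_continuous:
  fixes f :: "complex \<Rightarrow> 'a::euclidean_space"
  assumes f: "f \<in> borel_measurable L" and N: "0 < N"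
    and bound: "\<And>s. norm (f s) \<le> N" "\<And>s. norm s > N \<Longrightarrow> f s = 0" and "0 < e"
  obtains g where "g \<in> continuous_bounded_support" "Lp_energy (\<lambda>s. f s - g s) < e"
proof -
  let ?f = "\<lambda>s. if s \<in> sector \<alpha> then f s else 0"
  have "?f \<in> borel_measurable lebesgue"
    using f by (simp add: borel_measurable_if)
  then have "?f measurable_on UNIV" by (rule lebesgue_measurable_imp_measurable_on) simp
  then obtain Z k where Z: "negligible Z" and k: "\<And>n. continuous_on UNIV (k n)"
      and lim: "\<And>s. s \<notin> Z \<Longrightarrow> (\<lambda>n. k n s) \<longlonglongrightarrow> ?f s"
    unfolding measurable_on_def by auto
  \<comment> \<open>\<open>clip\<close> is the radial retraction onto the ball of radius
    \<open>N\<close>, and \<open>cut\<close> equals 1 up to radius \<open>N\<close> and 0 from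
    radius \<open>N + 1\<close> on. Together they leave the values of \<open>f\<close>
    unchanged.\<close>
  define clip where "clip x = (N / max N (norm x)) *\<^sub>R x" for x :: 'a
  define cut where "cut s = max 0 (min 1 (N + 1 - norm s))" for s :: complex
  define g where "g n s = cut s *\<^sub>R clip (k n s)" for n s
  have max0: "max N (norm x) \<noteq> 0" for x :: 'a using N by auto
  have clip_cont: "continuous_on UNIV clip"
    unfolding clip_def using max0 by (intro continuous_intros) auto
  have clip_le: "norm (clip x) \<le> N" for x
    using N by (auto simp: clip_def max_def field_simps)
  have cut: "0 \<le> cut s" "cut s \<le> 1" for s by (auto simp: cut_def)
  have g_le: "norm (g n s) \<le> N" for n s
    using mult_mono[OF cut(2) clip_le] N cut(1) by (simp add: g_def)
  have g_supp: "g n s = 0" if "norm s > N + 1" for n s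
    using that by (simp add: g_def cut_def)
  have g_cont: "continuous_on UNIV (g n)" for n
    unfolding g_def cut_def
    by (intro continuous_intros continuous_on_compose2[OF clip_cont k]) auto
  have g: "g n \<in> continuous_bounded_support" for n
    unfolding continuous_bounded_support_def using g_cont g_supp by blast
  have [measurable]: "f \<in> borel_measurable L" by fact
  have [measurable]: "g n \<in> borel_measurable L" for n
    using g by (intro borel_measurable_L continuous_bounded_support_borel)
  have [measurable]: "(\<lambda>s. indicator (cball 0 (N + 1)) s :: ennreal) \<in> borel_measurable L"
    by (intro borel_measurable_L borel_measurable_indicator) auto
  let ?W = "\<lambda>s. ennreal ((2 * N) powr p) * (ennreal (v s) * indicator (cball 0 (N + 1)) s)"
  have "(\<lambda>n. Lp_energy (\<lambda>s. f s - g n s)) \<longlonglongrightarrow> 0"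
  proof (rule Lp_energy_tendsto_0)
    show "?W \<in> borel_measurable L" by measurable
    have "(\<integral>\<^sup>+s. ?W s \<partial>L) = ennreal ((2 * N) powr p) * (\<integral>\<^sup>+s. ennreal (v s) * indicator (cball 0 (N + 1)) s \<partial>L)"
      by (rule nn_integral_cmult) measurable
    then show "(\<integral>\<^sup>+s. ?W s \<partial>L) < \<infinity>"
      using v_integrable_on_ball[of "N + 1"] by (simp add: ennreal_mult_less_top)
    show "ennreal (norm (f s - g n s) powr p * v s) \<le> ?W s" if s: "s \<in> sector \<alpha>" for n s
    proof (cases "norm s > N + 1")
      case False
      have "norm (f s - g n s) \<le> 2 * N"
        using norm_triangle_ineq4[of "f s" "g n s"] bound(1)[of s] g_le[of n s] by linarith
      then have "norm (f s - g n s) powr p * v s \<le> (2 * N) powr p * v s"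
        using v_pos[OF s] p_ge_1 by (intro mult_right_mono powr_mono2) auto
      then have "ennreal (norm (f s - g n s) powr p * v s) \<le> ennreal ((2 * N) powr p * v s)"
        by (rule ennreal_leI)
      then show ?thesis using False by (simp add: ennreal_mult')
    qed (use bound(2)[of s] g_supp[of s n] p_ge_1 in simp)
    have ptwise: "(\<lambda>n. f s - g n s) \<longlonglongrightarrow> 0" if s: "s \<in> sector \<alpha>" "s \<notin> Z" for s
    proof -
      have "(\<lambda>n. clip (k n s)) \<longlonglongrightarrow> clip (f s)"
        using lim[OF s(2)] s(1) clip_cont
        by (intro continuous_on_tendsto_compose[of UNIV clip]) auto
      then have "(\<lambda>n. f s - g n s) \<longlonglongrightarrow> f s - cut s *\<^sub>R clip (f s)"
        unfolding g_def by (intro tendsto_intros)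
      also have "clip (f s) = f s" using bound(1)[of s] N by (simp add: clip_def max_def)
      also have "cut s *\<^sub>R f s = f s" using bound(2)[of s] by (cases "norm s > N") (auto simp: cut_def)
      finally show ?thesis by simp
    qed
    show "AE s in L. (\<lambda>n. f s - g n s) \<longlonglongrightarrow> 0"
      unfolding AE_L_iff using Z
      by (intro AE_I'[of Z]) (auto simp: negligible_iff_null_sets intro: ccontr dest: ptwise)
  qed measurable
  then have "\<forall>\<^sub>F n in sequentially. Lp_energy (\<lambda>s. f s - g n s) < e"
    using \<open>0 < e\<close> by (rule order_tendstoD)
  then obtain n where "Lp_energy (\<lambda>s. f s - g n s) < e" using eventually_happens' sequentially_bot by blast
  then show ?thesis using that g by blast
qed

lemma continuous_bounded_support_dense:
  fixes f :: "complex \<Rightarrow> 'a::euclidean_space"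
  assumes f: "f \<in> borel_measurable L" "Lp_energy f < \<infinity>" and e: "0 < e"
  obtains g where "g \<in> continuous_bounded_support" "Lp_energy (\<lambda>s. f s - g s) < ennreal e"
proof -
  \<comment> \<open>Two errors of size \<open>d\<close>, multiplied by the constant
    \<open>2 powr p\<close> of the triangle inequality, add up to \<open>e\<close>.\<close>
  define d where "d = e / (2 * 2 powr p)"
  have d: "0 < ennreal d" using e by (simp add: d_def)
  obtain N :: nat where N: "0 < N"
    "Lp_energy (\<lambda>s. f s - (if norm s \<le> N \<and> norm (f s) \<le> N then f s else 0)) < ennreal d"
    using Lp_energy_truncate[OF f d] .
  define h where "h s = (if norm s \<le> N \<and> norm (f s) \<le> N then f s else 0)" for s
  have [measurable]: "f \<in> borel_measurable L" by fact
  have [measurable]: "(\<lambda>s. s) \<in> borel_measurable L" by (rule borel_measurable_L) simp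
  have h [measurable]: "h \<in> borel_measurable L" unfolding h_def by measurable
  have h_bounds: "0 < real N" "\<And>s. norm (h s) \<le> real N" "\<And>s. norm s > real N \<Longrightarrow> h s = 0"
    using N(1) by (auto simp: h_def)
  obtain g where g: "g \<in> continuous_bounded_support" "Lp_energy (\<lambda>s. h s - g s) < ennreal d"
    using bounded_approx_continuous[OF h h_bounds d] by blast
  have [measurable]: "g \<in> borel_measurable L"
    using g by (intro borel_measurable_L continuous_bounded_support_borel)
  have "Lp_energy (\<lambda>s. f s - g s) = Lp_energy (\<lambda>s. (f s - h s) + (h s - g s))" by simp
  also have "\<dots> \<le> ennreal (2 powr p) * (Lp_energy (\<lambda>s. f s - h s) + Lp_energy (\<lambda>s. h s - g s))"
    by (intro Lp_energy_add_le) measurable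
  also have "\<dots> < ennreal (2 powr p) * (ennreal d + ennreal d)"
    using N(2) g(2) unfolding h_def[symmetric]
    by (intro ennreal_mult_strict_left_mono add_strict_mono) auto
  also have "\<dots> = ennreal (2 powr p * (d + d))"
    using d by (simp add: ennreal_mult less_imp_le flip: mult_2)
  also have "2 powr p * (d + d) = e" by (simp add: d_def)
  finally show ?thesis using that g(1) by blast
qed

text \<open>
  Measurability matters here: the library gives non-measurable sets measure 0, so their upper
  density would not be 1. It follows from Tonelli after replacing \<open>v\<close> by a Borel version.
\<close>

lemma shifted_energy_sets:
  fixes f :: "complex \<Rightarrow> 'a::euclidean_space"
  assumes [measurable]: "f \<in> borel_measurable borel"
  shows "{t \<in> sector \<alpha>. Lp_energy (\<lambda>s. f (s + t)) < c} \<in> sets lebesgue"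
    and "{t \<in> sector \<alpha>. c < Lp_energy (\<lambda>s. f (s + t))} \<in> sets lebesgue"
proof -
  let ?V = "\<lambda>s. ennreal (v s) * indicator (sector \<alpha>) s"
  have V: "?V \<in> borel_measurable (completion lborel)"
    by (subst borel_measurable_restrict_space_iff_ennreal[symmetric]) auto
  obtain V where [measurable]: "V \<in> borel_measurable lborel" and AE: "AE s in lborel. ?V s = V s"
    using completion_ex_borel_measurable[OF V] by blast
  have eq: "Lp_energy (\<lambda>s. f (s + t)) = (\<integral>\<^sup>+s. ennreal (norm (f (s + t)) powr p) * V s \<partial>lborel)" for t
  proof -
    have "Lp_energy (\<lambda>s. f (s + t)) = (\<integral>\<^sup>+s. ennreal (norm (f (s + t)) powr p) * ?V s \<partial>lebesgue)"
      unfolding Lp_energy_def nn_integral_L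
      by (intro nn_integral_cong) (simp add: ennreal_mult' mult.assoc)
    also have "\<dots> = (\<integral>\<^sup>+s. ennreal (norm (f (s + t)) powr p) * ?V s \<partial>lborel)"
      by (rule nn_integral_completion)
    also have "\<dots> = (\<integral>\<^sup>+s. ennreal (norm (f (s + t)) powr p) * V s \<partial>lborel)"
      using AE by (intro nn_integral_cong_AE) auto
    finally show ?thesis .
  qed
  have [measurable]: "(\<lambda>t. \<integral>\<^sup>+s. ennreal (norm (f (s + t)) powr p) * V s \<partial>lborel) \<in> borel_measurable borel"
    by measurable
  have "{t \<in> sector \<alpha>. Lp_energy (\<lambda>s. f (s + t)) < c} \<in> sets borel"
    "{t \<in> sector \<alpha>. c < Lp_energy (\<lambda>s. f (s + t))} \<in> sets borel"
    unfolding eq by measurable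
  then show "{t \<in> sector \<alpha>. Lp_energy (\<lambda>s. f (s + t)) < c} \<in> sets lebesgue"
    "{t \<in> sector \<alpha>. c < Lp_energy (\<lambda>s. f (s + t))} \<in> sets lebesgue" by simp_all
qed

end

subsection \<open>Functions supported on shells\<close>

lemma measurable_nat_floor_norm [measurable]:
  "(\<lambda>s :: 'a::real_normed_vector. nat \<lfloor>norm s\<rfloor>) \<in> borel \<rightarrow>\<^sub>M count_space UNIV"
  by measurable

context weighted_sector
begin

lemma measurable_nat_floor_norm_L [measurable]: "(\<lambda>s. nat \<lfloor>norm s\<rfloor>) \<in> L \<rightarrow>\<^sub>M count_space UNIV"
  by (intro measurable_restrict_space1 measurable_completion) simp

text \<open>Shells are described by the floor of the norm and hence disjoint, in contrast to closed
  annuli, which share their boundary circles.\<close>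

definition tail_mass :: "nat set \<Rightarrow> nat \<Rightarrow> ennreal" where
  "tail_mass K n = (\<integral>\<^sup>+s. (if nat \<lfloor>norm s\<rfloor> \<in> K \<and> n \<le> nat \<lfloor>norm s\<rfloor> then ennreal (v s) else 0) \<partial>L)"

text \<open>Each half-open shell lies in the corresponding closed annulus, so every finite union of
  shells has mass at most the given sum; monotone convergence extends this bound to all
  shells.\<close>

lemma tail_mass_finite:
  assumes "(\<Sum>\<^sub>\<infinity>k\<in>K. \<integral>\<^sup>+s\<in>sector_annulus \<alpha> (real k) (real k + 1). ennreal (v s) \<partial>lebesgue) < \<infinity>"
  shows "tail_mass K 0 < \<infinity>"
proof -
  let ?I = "\<lambda>k. \<integral>\<^sup>+s\<in>sector_annulus \<alpha> (real k) (real k + 1). ennreal (v s) \<partial>lebesgue"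
  let ?f = "\<lambda>n s. if nat \<lfloor>norm s\<rfloor> \<in> K \<and> nat \<lfloor>norm s\<rfloor> < n then ennreal (v s) else 0"
  have f: "?f n \<in> borel_measurable L" for n by measurable
  have le: "(\<integral>\<^sup>+s. ?f n s \<partial>L) \<le> infsum ?I K" for n
  proof -
    let ?F = "K \<inter> {..<n}"
    let ?g = "\<lambda>k s. if nat \<lfloor>norm s\<rfloor> = k then ennreal (v s) else 0"
    have "?f n s = (\<Sum>k\<in>?F. ?g k s)" for s by simp
    then have "(\<integral>\<^sup>+s. ?f n s \<partial>L) = (\<integral>\<^sup>+s. (\<Sum>k\<in>?F. ?g k s) \<partial>L)" by simp
    also have "\<dots> = (\<Sum>k\<in>?F. \<integral>\<^sup>+s. ?g k s \<partial>L)" by (rule nn_integral_sum) measurable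
    also have "\<dots> \<le> (\<Sum>k\<in>?F. ?I k)"
    proof (rule sum_mono)
      fix k
      have "real k \<le> norm s \<and> norm s \<le> real k + 1" if "nat \<lfloor>norm s\<rfloor> = k" for s :: complex
        using that by (auto simp: nat_eq_iff2 floor_eq_iff)
      then show "(\<integral>\<^sup>+s. ?g k s \<partial>L) \<le> ?I k"
        unfolding nn_integral_L
        by (intro nn_integral_mono) (auto simp: indicator_def sector_annulus_def)
    qed
    also have "\<dots> \<le> infsum ?I K"
      by (subst nonneg_infsum_complete) (auto intro!: SUP_upper)
    finally show ?thesis .
  qed
  have "tail_mass K 0 = (\<integral>\<^sup>+s. (SUP n. ?f n s) \<partial>L)"
    unfolding tail_mass_def
  proof (rule nn_integral_cong, rule antisym)
    fix s
    show "(if nat \<lfloor>norm s\<rfloor> \<in> K \<and> 0 \<le> nat \<lfloor>norm s\<rfloor> then ennreal (v s) else 0) \<le> (SUP n. ?f n s)"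
      by (rule SUP_upper2[of "Suc (nat \<lfloor>norm s\<rfloor>)"]) auto
    show "(SUP n. ?f n s) \<le> (if nat \<lfloor>norm s\<rfloor> \<in> K \<and> 0 \<le> nat \<lfloor>norm s\<rfloor> then ennreal (v s) else 0)"
      by (rule SUP_least) auto
  qed
  also have "\<dots> = (SUP n. \<integral>\<^sup>+s. ?f n s \<partial>L)"
    using f by (intro nn_integral_monotone_convergence_SUP) (auto simp: incseq_def le_fun_def)
  also have "\<dots> \<le> infsum ?I K" by (intro SUP_least le)
  finally show ?thesis using assms by (rule le_less_trans)
qed

text \<open>Dominated convergence with the case \<open>n = 0\<close> as majorant: at a fixed point
  the integrand vanishes once \<open>n\<close> exceeds the index of its shell.\<close>

lemma tail_mass_tendsto_0:
  assumes "tail_mass K 0 < \<infinity>"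
  shows "tail_mass K \<longlonglongrightarrow> 0"
proof -
  have "(\<lambda>n. tail_mass K n) \<longlonglongrightarrow> (\<integral>\<^sup>+s. 0 \<partial>L)"
    unfolding tail_mass_def
  proof (rule nn_integral_dominated_convergence)
    show "(\<integral>\<^sup>+s. (if nat \<lfloor>norm s\<rfloor> \<in> K \<and> 0 \<le> nat \<lfloor>norm s\<rfloor> then ennreal (v s) else 0) \<partial>L) < \<infinity>"
      using assms unfolding tail_mass_def .
    have "(\<lambda>n. if nat \<lfloor>norm s\<rfloor> \<in> K \<and> n \<le> nat \<lfloor>norm s\<rfloor> then ennreal (v s) else 0) \<longlonglongrightarrow> 0" for s
      by (intro tendsto_eventually eventually_mono[OF eventually_gt_at_top[of "nat \<lfloor>norm s\<rfloor>"]]) auto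
    then show "AE s in L. (\<lambda>n. if nat \<lfloor>norm s\<rfloor> \<in> K \<and> n \<le> nat \<lfloor>norm s\<rfloor> then ennreal (v s) else 0) \<longlonglongrightarrow> 0"
      by simp
    show "(\<lambda>s. if nat \<lfloor>norm s\<rfloor> \<in> K \<and> n \<le> nat \<lfloor>norm s\<rfloor> then ennreal (v s) else 0) \<in> borel_measurable L"
      for n
      by measurable
    then show "(\<lambda>s. if nat \<lfloor>norm s\<rfloor> \<in> K \<and> 0 \<le> nat \<lfloor>norm s\<rfloor> then ennreal (v s) else 0)
        \<in> borel_measurable L" .
    show "AE s in L. (if nat \<lfloor>norm s\<rfloor> \<in> K \<and> n \<le> nat \<lfloor>norm s\<rfloor> then ennreal (v s) else 0)
        \<le> (if nat \<lfloor>norm s\<rfloor> \<in> K \<and> 0 \<le> nat \<lfloor>norm s\<rfloor> then ennreal (v s) else 0)" for n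
      by (intro AE_I2) auto
  qed simp
  then show ?thesis by simp
qed

definition shell_fun :: "nat set \<Rightarrow> 'a \<Rightarrow> complex \<Rightarrow> 'a::euclidean_space" where
  "shell_fun H b s = (if nat \<lfloor>norm s\<rfloor> \<in> H then b else 0)"

lemma shell_fun_borel [measurable]: "shell_fun H b \<in> borel_measurable borel"
  unfolding shell_fun_def by measurable

lemma Lp_energy_shell_fun:
  assumes "norm b = 1"
  shows "Lp_energy (shell_fun {k\<in>H. n \<le> k} b) = tail_mass H n"
  unfolding Lp_energy_def tail_mass_def shell_fun_def
  using assms by (intro nn_integral_cong) auto

lemma tail_mass_mono: "H \<subseteq> K \<Longrightarrow> tail_mass H n \<le> tail_mass K n"
  unfolding tail_mass_def by (intro nn_integral_mono) auto

text \<open>Shifts of norm at most \<open>x\<close> enlarge energies by a factor depending on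
  \<open>x\<close> alone, which a sufficiently late tail compensates. The tail is chosen for
  \<open>K\<close> and serves all subsets \<open>H\<close>, so \<open>H\<close> may later be built
  from \<phi> without circularity.\<close>

lemma ex_delay:
  assumes K: "tail_mass K 0 < \<infinity>"
  shows "\<exists>\<phi>. (\<forall>x. x \<le> \<phi> x) \<and>
    (\<forall>x H t (b :: 'a::euclidean_space). H \<subseteq> K \<longrightarrow> norm b = 1 \<longrightarrow> t \<in> sector \<alpha> \<longrightarrow> norm t \<le> real x \<longrightarrow>
      Lp_energy (\<lambda>s. shell_fun {k\<in>H. \<phi> x \<le> k} b (s + t)) \<le> ennreal (1 / (real x + 1)))"
proof -
  obtain M w where M: "1 \<le> M" and
    vM: "\<And>t t'. t \<in> sector \<alpha> \<Longrightarrow> t' \<in> sector \<alpha> \<Longrightarrow> v t \<le> M * exp (w * norm t') * v (t + t')"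
    using v_shift by blast
  \<comment> \<open>The absolute value of \<open>w\<close> makes the growth factor monotone in the
    norm of the shift, whatever the sign of \<open>w\<close>.\<close>
  have "\<exists>n\<ge>x. ennreal (M * exp (\<bar>w\<bar> * real x)) * tail_mass K n < ennreal (1 / (real x + 1))" for x :: nat
  proof -
    have "(\<lambda>n. ennreal (M * exp (\<bar>w\<bar> * real x)) * tail_mass K n) \<longlonglongrightarrow> ennreal (M * exp (\<bar>w\<bar> * real x)) * 0"
      by (intro ennreal_tendsto_cmult tail_mass_tendsto_0 K) simp
    then have "\<forall>\<^sub>F n in sequentially. ennreal (M * exp (\<bar>w\<bar> * real x)) * tail_mass K n < ennreal (1 / (real x + 1))"
      by (rule order_tendstoD) simp
    then have "\<forall>\<^sub>F n in sequentially. x \<le> n \<and>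
        ennreal (M * exp (\<bar>w\<bar> * real x)) * tail_mass K n < ennreal (1 / (real x + 1))"
      by (intro eventually_conj eventually_ge_at_top)
    then show ?thesis using eventually_happens' sequentially_bot by blast
  qed
  then obtain \<phi> where \<phi>: "\<And>x. x \<le> \<phi> x"
    "\<And>x. ennreal (M * exp (\<bar>w\<bar> * real x)) * tail_mass K (\<phi> x) < ennreal (1 / (real x + 1))"
    by metis
  show ?thesis
  proof (intro exI[of _ \<phi>] conjI allI impI)
    fix x H t and b :: 'a
    assume H: "H \<subseteq> K" and b: "norm b = 1" and t: "t \<in> sector \<alpha>" "norm t \<le> real x"
    have "v s \<le> M * exp (\<bar>w\<bar> * real x) * v (s + t)" if s: "s \<in> sector \<alpha>" for s
    proof -
      have "w * norm t \<le> \<bar>w\<bar> * real x" using t(2) by (intro mult_mono) auto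
      then have "M * exp (w * norm t) * v (s + t) \<le> M * exp (\<bar>w\<bar> * real x) * v (s + t)"
        using M v_pos[OF sector_add[OF s t(1)]] by (intro mult_right_mono mult_left_mono) auto
      then show ?thesis using vM[OF s t(1)] by simp
    qed
    then have "Lp_energy (\<lambda>s. shell_fun {k\<in>H. \<phi> x \<le> k} b (s + t)) \<le>
        ennreal (M * exp (\<bar>w\<bar> * real x)) * Lp_energy (shell_fun {k\<in>H. \<phi> x \<le> k} b)"
      using t(1) M by (intro Lp_energy_shift_le borel_measurable_L shell_fun_borel) auto
    also have "\<dots> \<le> ennreal (M * exp (\<bar>w\<bar> * real x)) * tail_mass K (\<phi> x)"
      unfolding Lp_energy_shell_fun[OF b] by (intro mult_left_mono tail_mass_mono H) auto
    also have "\<dots> \<le> ennreal (1 / (real x + 1))" using \<phi>(2) by (rule less_imp_le)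
    finally show "Lp_energy (\<lambda>s. shell_fun {k\<in>H. \<phi> x \<le> k} b (s + t)) \<le> ennreal (1 / (real x + 1))" .
  qed (rule \<phi>(1))
qed

section \<open>Lower bound for shifted energies by the mass near the origin\<close>

definition base_mass :: ennreal where
  "base_mass = (\<integral>\<^sup>+s. ennreal (v s) * indicator (sector_ball \<alpha> 1) s \<partial>L)"

lemma sector_ball_indicator_L [measurable]:
  "(\<lambda>s. indicator (sector_ball \<alpha> r) s :: ennreal) \<in> borel_measurable L"
  by (intro borel_measurable_L borel_measurable_indicator sector_ball_borel)

text \<open>A strictly positive weight cannot have integral 0 over a set of positive
  measure.\<close>

lemma base_mass_pos: "0 < base_mass"
proof (rule ccontr)
  assume "\<not> ?thesis"
  then have "(\<integral>\<^sup>+s. ennreal (v s) * indicator (sector_ball \<alpha> 1) s \<partial>L) = 0" by (simp add: base_mass_def)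
  then have "AE s in L. ennreal (v s) * indicator (sector_ball \<alpha> 1) s = 0"
    by (subst (asm) nn_integral_0_iff_AE) measurable
  then have "AE s in lebesgue. s \<notin> sector_ball \<alpha> 1"
    unfolding AE_L_iff
    by eventually_elim (auto simp: sector_ball_def indicator_def ennreal_eq_0_iff dest: v_pos)
  then have "sector_ball \<alpha> 1 \<in> null_sets lebesgue"
    using sector_ball_lmeasurable by (subst AE_iff_null_sets) (auto simp: fmeasurableD)
  then show False using sector_ball_not_negligible[of 1] by (simp add: negligible_iff_null_sets)
qed

lemma base_mass_finite: "base_mass < \<infinity>"
proof -
  have "base_mass \<le> (\<integral>\<^sup>+s. ennreal (v s) * indicator (cball 0 1) s \<partial>L)"
    unfolding base_mass_def
    by (intro nn_integral_mono mult_left_mono) (auto simp: indicator_def sector_ball_def)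
  then show ?thesis using v_integrable_on_ball[of 1] by (rule le_less_trans)
qed

text \<open>For \<open>s\<close> of norm below 1 the norm of \<open>s + t\<close> differs from that
  of \<open>t\<close> by less than 1, so \<open>s + t\<close> lies in one of the three named shells.
  The shifted function thus has norm 1 on the whole unit sector ball.\<close>

lemma base_mass_le_shifted_energy:
  assumes b: "norm b = 1" and t: "1 \<le> norm t"
    and k: "nat \<lfloor>norm t\<rfloor> - 1 \<in> H" "nat \<lfloor>norm t\<rfloor> \<in> H" "nat \<lfloor>norm t\<rfloor> + 1 \<in> H"
  shows "base_mass \<le> Lp_energy (\<lambda>s. shell_fun H b (s + t))"
  unfolding base_mass_def Lp_energy_def
proof (rule nn_integral_mono)
  fix s assume "s \<in> space L"
  show "ennreal (v s) * indicator (sector_ball \<alpha> 1) s \<le> ennreal (norm (shell_fun H b (s + t)) powr p * v s)"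
  proof (cases "s \<in> sector_ball \<alpha> 1")
    case True
    then have "norm s < 1" by (simp add: sector_ball_def)
    then have "\<bar>norm (s + t) - norm t\<bar> < 1"
      using norm_triangle_ineq3[of "s + t" t] by simp
    then have "nat \<lfloor>norm (s + t)\<rfloor> \<in> {nat \<lfloor>norm t\<rfloor> - 1, nat \<lfloor>norm t\<rfloor>, nat \<lfloor>norm t\<rfloor> + 1}"
      using t by (auto simp: abs_less_iff) linarith
    then have "nat \<lfloor>norm (s + t)\<rfloor> \<in> H" using k by auto
    then show ?thesis using b by (simp add: shell_fun_def True)
  qed simp
qed

end

subsection \<open>Dense distributional chaos\<close>

context weighted_sector
begin

lemma Lp_energy_diff_finite:
  fixes f g :: "complex \<Rightarrow> 'a::euclidean_space"
  assumes [measurable]: "f \<in> borel_measurable L" "g \<in> borel_measurable L"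
    and fin: "Lp_energy f < \<infinity>" "Lp_energy g < \<infinity>"
  shows "Lp_energy (\<lambda>s. f s - g s) < \<infinity>"
proof -
  have "Lp_energy (\<lambda>s. f s - g s) = Lp_energy (\<lambda>s. f s + (-1) *\<^sub>R g s)" by simp
  also have "\<dots> \<le> ennreal (2 powr p) * (Lp_energy f + Lp_energy (\<lambda>s. (-1) *\<^sub>R g s))"
    by (intro Lp_energy_add_le) measurable
  also have "\<dots> < \<infinity>"
    using fin by (subst Lp_energy_scaleR) (auto simp: ennreal_mult_less_top)
  finally show ?thesis .
qed

text \<open>Once \<open>t\<close> has norm above \<open>(1 + tan \<alpha>) * R\<close>, the whole
  shifted sector lies beyond radius \<open>R\<close>, and the difference is a multiple of the
  shifted shell function. Both density conditions then follow from the two criteria for density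
  one.\<close>

lemma dist_chaotic_pairI:
  fixes f1 f2 :: "complex \<Rightarrow> 'a::euclidean_space"
  assumes f [measurable]: "f1 \<in> borel_measurable borel" "f2 \<in> borel_measurable borel"
    and fin: "Lp_energy f1 < \<infinity>" "Lp_energy f2 < \<infinity>"
    and diff: "\<And>s. norm s > R \<Longrightarrow> f1 s - f2 s = c *\<^sub>R shell_fun H b s" and c: "c \<noteq> 0" and b: "norm b = 1"
    and gaps: "\<And>m. \<exists>a>m. \<forall>t\<in>sector \<alpha>. (1 + tan \<alpha>) * real a < norm t \<and> norm t < real (Suc m * a) \<longrightarrow>
      Lp_energy (\<lambda>s. shell_fun H b (s + t)) \<le> ennreal (1 / (real m + 1))"
    and dense: "\<And>\<epsilon> N. 0 < \<epsilon> \<Longrightarrow>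
      \<exists>n>N. real (card ({..<n} - {k. 0 < k \<and> k - 1 \<in> H \<and> k \<in> H \<and> k + 1 \<in> H})) \<le> \<epsilon> * real n"
  shows "dist_chaotic_pair \<alpha> (Lp_dist \<alpha> p v) (translation \<alpha>) (ae_class \<alpha> f1) (ae_class \<alpha> f2)"
proof -
  let ?C = "1 + tan \<alpha>"
  let ?E = "\<lambda>t. Lp_energy (\<lambda>s. f1 (s + t) - f2 (s + t))"
  have fL: "f1 \<in> borel_measurable L" "f2 \<in> borel_measurable L"
    using f by (auto intro: borel_measurable_L)
  have dL: "(\<lambda>s. f1 s - f2 s) \<in> borel_measurable L" using fL by (rule borel_measurable_diff)
  have C: "1 \<le> ?C" using tan_\<alpha>_pos by simp
  have E_fin: "?E t < \<infinity>" if "t \<in> sector \<alpha>" for t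
    using Lp_energy_shift_finite[OF dL Lp_energy_diff_finite[OF fL fin] that] .
  have dist: "Lp_dist \<alpha> p v (translation \<alpha> t (ae_class \<alpha> f1)) (translation \<alpha> t (ae_class \<alpha> f2)) =
      enn2real (?E t) powr (1 / p)" if "t \<in> sector \<alpha>" for t
    using that by (rule Lp_dist_translation[OF fL])
  have E_eq: "?E t = ennreal (\<bar>c\<bar> powr p) * Lp_energy (\<lambda>s. shell_fun H b (s + t))"
    if t: "t \<in> sector \<alpha>" "?C * R < norm t" for t
  proof -
    have "f1 (s + t) - f2 (s + t) = c *\<^sub>R shell_fun H b (s + t)" if "s \<in> sector \<alpha>" for s
    proof (rule diff)
      have "?C * R < ?C * norm (s + t)" using norm_le_norm_add[OF that t(1)] t(2) by linarith
      then show "R < norm (s + t)" using C by simp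
    qed
    then have "?E t = Lp_energy (\<lambda>s. c *\<^sub>R shell_fun H b (s + t))"
      by (intro Lp_energy_cong_AE AE_I2) (simp add: space_restrict_space)
    also have "\<dots> = ennreal (\<bar>c\<bar> powr p) * Lp_energy (\<lambda>s. shell_fun H b (s + t))"
      by (intro Lp_energy_scaleR measurable_shift_L[where f = "shell_fun H b"] borel_measurable_L
          shell_fun_borel t)
    finally show ?thesis .
  qed
  have D_borel: "(\<lambda>s. f1 s - f2 s) \<in> borel_measurable borel" by measurable
  note sets = shifted_energy_sets[OF D_borel]
  have small: "sector_upper_density \<alpha> {t \<in> sector \<alpha>.
      Lp_dist \<alpha> p v (translation \<alpha> t (ae_class \<alpha> f1)) (translation \<alpha> t (ae_class \<alpha> f2)) < \<epsilon>} = 1"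
    if \<epsilon>: "0 < \<epsilon>" for \<epsilon>
  proof -
    have "{t \<in> sector \<alpha>. Lp_dist \<alpha> p v (translation \<alpha> t (ae_class \<alpha> f1)) (translation \<alpha> t (ae_class \<alpha> f2)) < \<epsilon>}
        = {t \<in> sector \<alpha>. ?E t < ennreal (\<epsilon> powr p)}"
      using root_less_iff[OF E_fin \<epsilon>] by (auto simp: dist)
    moreover have "sector_upper_density \<alpha> {t \<in> sector \<alpha>. ?E t < ennreal (\<epsilon> powr p)} = 1"
    proof (rule sector_upper_density_eq_1_if_annuli[OF sets(1), of ?C])
      fix m :: nat
      \<comment> \<open>Taking \<open>m'\<close> at least \<open>m\<close> makes the gap long
        enough, \<open>m' > R\<close> puts it where the difference is known, and the last bound
        brings the energy below \<open>\<epsilon> powr p\<close>.\<close>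
      obtain m' :: nat where m': "max (max (real m) R) (\<bar>c\<bar> powr p / \<epsilon> powr p) < real m'"
        using reals_Archimedean2 by blast
      obtain a where a: "a > m'" and
        ga: "\<forall>t\<in>sector \<alpha>. ?C * real a < norm t \<and> norm t < real (Suc m' * a) \<longrightarrow>
          Lp_energy (\<lambda>s. shell_fun H b (s + t)) \<le> ennreal (1 / (real m' + 1))"
        using gaps by blast
      have "t \<in> {t \<in> sector \<alpha>. ?E t < ennreal (\<epsilon> powr p)}"
        if t: "t \<in> sector \<alpha>" "?C * real a < norm t" "norm t < real (Suc m * a)" for t
      proof -
        have "R \<le> real a" using m' a by linarith
        then have "?C * R \<le> ?C * real a" using C by (intro mult_left_mono) auto
        then have "?E t = ennreal (\<bar>c\<bar> powr p) * Lp_energy (\<lambda>s. shell_fun H b (s + t))"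
          using t by (intro E_eq) auto
        also have "Suc m * a \<le> Suc m' * a" using m' by (intro mult_right_mono) auto
        then have "norm t < real (Suc m' * a)" using t(3) of_nat_mono order_less_le_trans by blast
        then have "ennreal (\<bar>c\<bar> powr p) * Lp_energy (\<lambda>s. shell_fun H b (s + t))
            \<le> ennreal (\<bar>c\<bar> powr p) * ennreal (1 / (real m' + 1))"
          using ga t by (intro mult_left_mono) auto
        also have "\<dots> = ennreal (\<bar>c\<bar> powr p / (real m' + 1))" by (simp flip: ennreal_mult)
        also have "\<bar>c\<bar> powr p < \<epsilon> powr p * real m'" using m' \<epsilon> by (simp add: field_simps)
        then have "\<bar>c\<bar> powr p / (real m' + 1) < \<epsilon> powr p"
          using \<epsilon> by (simp add: field_simps add_strict_increasing)
        then have "ennreal (\<bar>c\<bar> powr p / (real m' + 1)) < ennreal (\<epsilon> powr p)"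
          by (intro ennreal_lessI) (use \<epsilon> in auto)
        finally show ?thesis using t(1) by simp
      qed
      then show "\<exists>a>m. \<forall>t\<in>sector \<alpha>. ?C * real a < norm t \<and> norm t < real (Suc m * a) \<longrightarrow>
          t \<in> {t \<in> sector \<alpha>. ?E t < ennreal (\<epsilon> powr p)}"
        using m' a by (intro exI[of _ a]) auto
    qed (use C in simp)
    ultimately show ?thesis by simp
  qed
  define q where "q = enn2real base_mass"
  have q: "base_mass = ennreal q" "0 < q"
    using base_mass_pos base_mass_finite by (auto simp: q_def enn2real_positive_iff)
  \<comment> \<open>The p-th power of \<delta> is half of the lower bound
    \<open>\<bar>c\<bar> powr p * q\<close>, which leaves the required strict inequality.\<close>
  define \<delta> where "\<delta> = (\<bar>c\<bar> powr p * q / 2) powr (1 / p)"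
  have \<delta>: "0 < \<delta>" "\<delta> powr p = \<bar>c\<bar> powr p * q / 2"
    using q c p_ge_1 by (auto simp: \<delta>_def powr_powr)
  have "{t \<in> sector \<alpha>. \<delta> < Lp_dist \<alpha> p v (translation \<alpha> t (ae_class \<alpha> f1)) (translation \<alpha> t (ae_class \<alpha> f2))}
      = {t \<in> sector \<alpha>. ennreal (\<delta> powr p) < ?E t}"
    using root_greater_iff[OF E_fin \<delta>(1)] by (auto simp: dist)
  moreover have "sector_upper_density \<alpha> {t \<in> sector \<alpha>. ennreal (\<delta> powr p) < ?E t} = 1"
  proof (rule sector_upper_density_eq_1_if_nat[OF sets(2)])
    \<comment> \<open>From shell \<open>k0\<close> on the difference is given by the shell function.
      The summand 1 makes the comparison with \<open>?C * R\<close> strict and also ensures that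
      \<open>t\<close> has norm at least 1.\<close>
    define k0 where "k0 = nat \<lceil>?C * R\<rceil> + 1"
    let ?T = "{k. 0 < k \<and> k - 1 \<in> H \<and> k \<in> H \<and> k + 1 \<in> H}"
    fix t assume t: "t \<in> sector \<alpha>" "nat \<lfloor>norm t\<rfloor> \<in> ?T \<inter> {k0..}"
    have k0: "k0 \<le> nat \<lfloor>norm t\<rfloor>" using t(2) by simp
    then have "real k0 \<le> norm t" by (simp add: le_nat_floor le_nat_iff le_floor_iff)
    moreover have "?C * R < real k0" unfolding k0_def by linarith
    ultimately have eq: "?E t = ennreal (\<bar>c\<bar> powr p) * Lp_energy (\<lambda>s. shell_fun H b (s + t))"
      using t(1) by (intro E_eq) auto
    have "1 \<le> real k0" by (simp add: k0_def)
    then have "base_mass \<le> Lp_energy (\<lambda>s. shell_fun H b (s + t))"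
      using t(2) \<open>real k0 \<le> norm t\<close> by (intro base_mass_le_shifted_energy b) auto
    have "ennreal (\<delta> powr p) < ennreal (\<bar>c\<bar> powr p * q)"
      unfolding \<delta>(2) using q c by (intro ennreal_lessI) auto
    also have "\<dots> = ennreal (\<bar>c\<bar> powr p) * base_mass"
      using q by (simp add: ennreal_mult)
    also have "\<dots> \<le> ?E t"
      unfolding eq by (rule mult_left_mono) (fact, simp)
    finally show "t \<in> {t \<in> sector \<alpha>. ennreal (\<delta> powr p) < ?E t}" by (intro CollectI conjI t(1))
  next
    define k0 where "k0 = nat \<lceil>?C * R\<rceil> + 1"
    let ?T = "{k. 0 < k \<and> k - 1 \<in> H \<and> k \<in> H \<and> k + 1 \<in> H}"
    fix \<epsilon> :: real and N :: nat assume \<epsilon>: "0 < \<epsilon>"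
    \<comment> \<open>The second half of \<open>\<epsilon> * n\<close> absorbs the \<open>k0\<close>
      initial indices that are given up.\<close>
    obtain n where n: "n > max N (nat \<lceil>2 * real k0 / \<epsilon>\<rceil>)" "real (card ({..<n} - ?T)) \<le> \<epsilon> / 2 * real n"
      using dense[OF half_gt_zero[OF \<epsilon>]] by blast
    have "{..<n} - ?T \<inter> {k0..} \<subseteq> ({..<n} - ?T) \<union> {..<k0}" by auto
    then have "card ({..<n} - ?T \<inter> {k0..}) \<le> card (({..<n} - ?T) \<union> {..<k0})"
      by (intro card_mono) auto
    also have "\<dots> \<le> card ({..<n} - ?T) + card {..<k0}" by (rule card_Un_le)
    finally have "real (card ({..<n} - ?T \<inter> {k0..})) \<le> real (card ({..<n} - ?T)) + real k0" by simp
    moreover have "2 * real k0 / \<epsilon> < real n" using n(1) by linarith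
    then have "real k0 \<le> \<epsilon> / 2 * real n" using \<epsilon> by (simp add: field_simps)
    ultimately have "real (card ({..<n} - ?T \<inter> {k0..})) \<le> \<epsilon> * real n" using n(2) by linarith
    then show "\<exists>n>N. real (card ({..<n} - ?T \<inter> {k0..})) \<le> \<epsilon> * real n"
      using n(1) by (intro exI[of _ n]) auto
  qed
  ultimately show ?thesis
    unfolding dist_chaotic_pair_def using small \<delta>(1) by (intro exI[of _ \<delta>]) simp
qed

text \<open>A class keeps distance 0 from itself under every translation, so the set of times with
  distance above \<delta> would be empty, of density 0. This spares a direct comparison of classes
  later.\<close>

lemma dist_chaotic_pair_neq:
  fixes F G :: "(complex \<Rightarrow> 'a::euclidean_space) set"
  assumes F: "F = ae_class \<alpha> f" "f \<in> borel_measurable L"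
    and chaotic: "dist_chaotic_pair \<alpha> (Lp_dist \<alpha> p v) (translation \<alpha>) F G"
  shows "F \<noteq> G"
proof
  assume "F = G"
  have "Lp_dist \<alpha> p v (translation \<alpha> t F) (translation \<alpha> t F) = 0" if "t \<in> sector \<alpha>" for t
    unfolding F(1) Lp_dist_translation[OF F(2) F(2) that] using p_ge_1 by (simp add: Lp_energy_def)
  then have "{t \<in> sector \<alpha>. Lp_dist \<alpha> p v (translation \<alpha> t F) (translation \<alpha> t G) > \<delta>} = {}"
    if "0 < \<delta>" for \<delta>
    using that \<open>F = G\<close> by auto
  then have "sector_upper_density \<alpha> {} = 1"
    using chaotic unfolding dist_chaotic_pair_def by metis
  then show False by (simp add: sector_upper_density_def Limsup_const)
qed

text \<open>The real multiples of one tent function form a copy of the real line.\<close>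

lemma uncountable_continuous_bounded_support:
  "uncountable (continuous_bounded_support :: (complex \<Rightarrow> 'a::euclidean_space) set)"
proof
  assume count: "countable (continuous_bounded_support :: (complex \<Rightarrow> 'a) set)"
  obtain b :: 'a where "b \<in> Basis" using nonempty_Basis by blast
  then have b: "b \<noteq> 0" by auto
  let ?g = "\<lambda>c s :: complex. (c * max 0 (1 - norm s)) *\<^sub>R b"
  have g: "?g c \<in> continuous_bounded_support" for c
    unfolding continuous_bounded_support_def
    by (auto intro!: continuous_intros exI[of _ 1])
  have inj: "inj ?g"
  proof (rule injI)
    fix c d assume "?g c = ?g d"
    from fun_cong[OF this, of 0] show "c = d" using b by simp
  qed
  have "countable (range ?g)" by (rule countable_subset[OF image_subsetI count]) (rule g)
  then have "countable (UNIV :: real set)" using inj by (rule countable_image_inj_on)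
  then show False using uncountable_UNIV_real by simp
qed

text \<open>A general Euclidean value space covers real and complex functions at once; a unit basis
  vector \<open>b\<close> takes the place of the constant 1.\<close>

theorem densely_dist_chaotic_Lp:
  assumes K: "nat_upper_density K = 1"
    and sum: "(\<Sum>\<^sub>\<infinity>k\<in>K. \<integral>\<^sup>+s\<in>sector_annulus \<alpha> (real k) (real k + 1). ennreal (v s) \<partial>lebesgue) < \<infinity>"
  shows "densely_dist_chaotic \<alpha>
    (Lp_space \<alpha> p v :: (complex \<Rightarrow> 'a::euclidean_space) set set) (Lp_dist \<alpha> p v) (translation \<alpha>)"
proof -
  obtain b :: 'a where "b \<in> Basis" using nonempty_Basis by blast
  then have b: "norm b = 1" by simp
  have mass: "tail_mass K 0 < \<infinity>" by (rule tail_mass_finite[OF sum])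
  obtain \<phi> where \<phi>: "\<forall>x. x \<le> \<phi> x"
    and delay: "\<forall>x H t (b :: 'a). H \<subseteq> K \<longrightarrow> norm b = 1 \<longrightarrow> t \<in> sector \<alpha> \<longrightarrow> norm t \<le> real x \<longrightarrow>
      Lp_energy (\<lambda>s. shell_fun {k\<in>H. \<phi> x \<le> k} b (s + t)) \<le> ennreal (1 / (real x + 1))"
    using ex_delay[OF mass] by (elim exE conjE)
  obtain J where J_dense: "\<And>\<epsilon> N. \<epsilon> > 0 \<Longrightarrow> \<exists>n>N. real (card ({..<n} - K \<inter> J)) \<le> \<epsilon> * real n"
    and J_gaps: "\<And>m. \<exists>a>m. \<forall>k\<in>J. k < a \<or> \<phi> (Suc m * a) \<le> k"
    using upper_density_one_with_gaps[OF K \<phi>[rule_format]] by metis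
  define H where "H = K \<inter> J"
  define h where "h = shell_fun H b"
  have h_borel [measurable]: "h \<in> borel_measurable borel" unfolding h_def by (rule shell_fun_borel)
  have h_fin: "Lp_energy h < \<infinity>"
  proof -
    have "Lp_energy h = tail_mass H 0" using Lp_energy_shell_fun[OF b, of H 0] by (simp add: h_def)
    also have "\<dots> \<le> tail_mass K 0" by (rule tail_mass_mono) (simp add: H_def)
    finally show ?thesis using mass by (rule le_less_trans)
  qed
  have gaps: "\<exists>a>m. \<forall>t\<in>sector \<alpha>. (1 + tan \<alpha>) * real a < norm t \<and> norm t < real (Suc m * a) \<longrightarrow>
      Lp_energy (\<lambda>s. shell_fun H b (s + t)) \<le> ennreal (1 / (real m + 1))" for m
  proof -
    obtain a where a: "a > m" "\<forall>k\<in>J. k < a \<or> \<phi> (Suc m * a) \<le> k" using J_gaps by blast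
    have "Lp_energy (\<lambda>s. shell_fun H b (s + t)) \<le> ennreal (1 / (real m + 1))"
      if t: "t \<in> sector \<alpha>" "(1 + tan \<alpha>) * real a < norm t" "norm t < real (Suc m * a)" for t
    proof -
      \<comment> \<open>All of \<open>s + t\<close> lies beyond radius \<open>a\<close>, so the
        charged shells below \<open>a\<close> are out of reach and the next ones start only at
        \<open>\<phi> (Suc m * a)\<close>.\<close>
      have "shell_fun H b (s + t) = shell_fun {k\<in>H. \<phi> (Suc m * a) \<le> k} b (s + t)"
        if s: "s \<in> sector \<alpha>" for s
      proof -
        have "(1 + tan \<alpha>) * real a < (1 + tan \<alpha>) * norm (s + t)"
          using norm_le_norm_add[OF s t(1)] t(2) by linarith
        then have "real a < norm (s + t)" using tan_\<alpha>_pos by simp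
        then have "a \<le> nat \<lfloor>norm (s + t)\<rfloor>" by (simp add: le_nat_floor)
        then show ?thesis using a(2) unfolding shell_fun_def H_def by force
      qed
      then have "Lp_energy (\<lambda>s. shell_fun H b (s + t)) =
          Lp_energy (\<lambda>s. shell_fun {k\<in>H. \<phi> (Suc m * a) \<le> k} b (s + t))"
        by (intro Lp_energy_cong_AE AE_I2) (simp add: space_restrict_space)
      also have "\<dots> \<le> ennreal (1 / (real (Suc m * a) + 1))"
        using t b by (intro delay[rule_format]) (auto simp: H_def)
      also have "\<dots> \<le> ennreal (1 / (real m + 1))"
      proof (intro ennreal_leI divide_left_mono)
        have "m \<le> Suc m * a" using a(1) by (simp add: trans_le_add1)
        then show "real m + 1 \<le> real (Suc m * a) + 1" by (simp only: of_nat_le_iff add_le_cancel_right)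
      qed (auto intro!: mult_pos_pos add_nonneg_pos simp del: of_nat_Suc of_nat_mult)
      finally show ?thesis .
    qed
    then show ?thesis using a(1) by blast
  qed
  have dense: "\<exists>n>N. real (card ({..<n} - {k. 0 < k \<and> k - 1 \<in> H \<and> k \<in> H \<and> k + 1 \<in> H})) \<le> \<epsilon> * real n"
    if "0 < \<epsilon>" for \<epsilon> N
    using J_dense that unfolding H_def[symmetric] by (rule frequently_card_three_consecutive)
  obtain \<psi> :: "(complex \<Rightarrow> 'a) \<Rightarrow> real" where \<psi>: "inj_on \<psi> {g. continuous_on UNIV g}"
    "\<And>g. 0 \<le> \<psi> g" "\<And>g. \<psi> g < 1"
    using continuous_functions_inj_unit_interval by blast
  let ?I = "(continuous_bounded_support :: (complex \<Rightarrow> 'a) set) \<times> (UNIV :: nat set)"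
  \<comment> \<open>From \<rho> one recovers \<open>n + \<psi> g\<close>, whose integer and
    fractional parts give back \<open>n\<close> and \<open>g\<close>; moreover \<rho> is at most
    \<open>1 / (n + 1)\<close>.\<close>
  define \<rho> where "\<rho> x = 1 / (real (snd x) + 1 + \<psi> (fst x))" for x :: "(complex \<Rightarrow> 'a) \<times> nat"
  define f where "f x s = fst x s + \<rho> x *\<^sub>R h s" for x s
  have inj: "\<rho> x \<noteq> \<rho> y" if xy: "x \<in> ?I" "y \<in> ?I" "x \<noteq> y" for x y
  proof
    assume "\<rho> x = \<rho> y"
    then have eq: "real (snd x) + \<psi> (fst x) = real (snd y) + \<psi> (fst y)" by (simp add: \<rho>_def)
    then have "snd x = snd y"
      using \<psi>(2)[of "fst x"] \<psi>(3)[of "fst x"] \<psi>(2)[of "fst y"] \<psi>(3)[of "fst y"] by linarith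
    with eq have "\<psi> (fst x) = \<psi> (fst y)" by simp
    then have "fst x = fst y"
      using xy \<psi>(1) by (auto simp: continuous_bounded_support_def inj_on_def)
    with \<open>snd x = snd y\<close> xy(3) show False by (simp add: prod_eq_iff)
  qed
  have f_borel [measurable]: "f x \<in> borel_measurable borel" if "x \<in> ?I" for x
  proof -
    have [measurable]: "fst x \<in> borel_measurable borel"
      using that by (intro continuous_bounded_support_borel) auto
    show ?thesis unfolding f_def by measurable
  qed
  have h_L [measurable]: "h \<in> borel_measurable L" by (rule borel_measurable_L) fact
  have f_fin: "Lp_energy (f x) < \<infinity>" if "x \<in> ?I" for x
  proof -
    have [measurable]: "fst x \<in> borel_measurable L"
      using that by (intro borel_measurable_L continuous_bounded_support_borel) auto
    have "Lp_energy (f x) \<le> ennreal (2 powr p) * (Lp_energy (fst x) + Lp_energy (\<lambda>s. \<rho> x *\<^sub>R h s))"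
      unfolding f_def by (intro Lp_energy_add_le) measurable
    also have "\<dots> < \<infinity>"
      using continuous_bounded_support_energy_finite[of "fst x"] that h_fin
      by (subst Lp_energy_scaleR) (auto simp: ennreal_mult_less_top)
    finally show ?thesis .
  qed
  have chaotic: "dist_chaotic_pair \<alpha> (Lp_dist \<alpha> p v) (translation \<alpha>) (ae_class \<alpha> (f x)) (ae_class \<alpha> (f y))"
    if xy: "x \<in> ?I" "y \<in> ?I" "x \<noteq> y" for x y
  proof -
    obtain R1 R2 where R: "\<And>s. norm s > R1 \<Longrightarrow> fst x s = 0" "\<And>s. norm s > R2 \<Longrightarrow> fst y s = 0"
      using xy unfolding continuous_bounded_support_def by fastforce
    show ?thesis
    proof (rule dist_chaotic_pairI)
      show "f x s - f y s = (\<rho> x - \<rho> y) *\<^sub>R shell_fun H b s" if "norm s > max R1 R2" for s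
        using that R by (simp add: f_def h_def algebra_simps)
      show "\<rho> x - \<rho> y \<noteq> 0" using inj[OF xy] by simp
    qed (use xy f_borel f_fin b gaps dense in auto)
  qed
  define S where "S = (\<lambda>x. ae_class \<alpha> (f x)) ` ?I"
  have "dist_scrambled_set \<alpha> (Lp_space \<alpha> p v) (Lp_dist \<alpha> p v) (translation \<alpha>) S"
    unfolding dist_scrambled_set_def
  proof (intro conjI ballI impI)
    show "S \<subseteq> Lp_space \<alpha> p v"
      using f_borel f_fin by (auto simp: S_def Lp_space_def Lp_fun_iff borel_measurable_L)
    \<comment> \<open>Different indices give chaotic pairs, hence different classes, so the
      uncountability of the index set passes to \<open>S\<close>.\<close>
    have "inj_on (\<lambda>x. ae_class \<alpha> (f x)) ?I"
    proof (rule inj_onI, rule ccontr)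
      fix x y assume xy: "x \<in> ?I" "y \<in> ?I" "ae_class \<alpha> (f x) = ae_class \<alpha> (f y)" "x \<noteq> y"
      have "ae_class \<alpha> (f x) \<noteq> ae_class \<alpha> (f y)"
        using chaotic[OF xy(1,2,4)] borel_measurable_L[OF f_borel[OF xy(1)]]
        by (intro dist_chaotic_pair_neq[OF refl])
      then show False using xy(3) by simp
    qed
    moreover have "uncountable ?I"
      using uncountable_continuous_bounded_support countable_image[of ?I fst] by auto
    ultimately show "uncountable S" unfolding S_def using countable_image_inj_on by blast
  next
    fix F G assume "F \<in> S" "G \<in> S" "F \<noteq> G"
    then show "dist_chaotic_pair \<alpha> (Lp_dist \<alpha> p v) (translation \<alpha>) F G"
      unfolding S_def using chaotic by blast
  qed
  moreover have "\<exists>G\<in>S. Lp_dist \<alpha> p v F G < \<epsilon>"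
    if "F \<in> Lp_space \<alpha> p v" and \<epsilon>: "0 < \<epsilon>" for F and \<epsilon> :: real
  proof -
    obtain f0 where F: "F = ae_class \<alpha> f0" "f0 \<in> borel_measurable L" "Lp_energy f0 < \<infinity>"
      using \<open>F \<in> Lp_space \<alpha> p v\<close> by (auto simp: Lp_space_def Lp_fun_iff)
    define e where "e = \<epsilon> powr p / (2 * 2 powr p)"
    have e: "0 < e" "2 powr p * (e + e) = \<epsilon> powr p" using \<epsilon> by (auto simp: e_def)
    obtain g where g: "g \<in> continuous_bounded_support" "Lp_energy (\<lambda>s. f0 s - g s) < ennreal e"
      using continuous_bounded_support_dense[OF F(2,3) e(1)] .
    \<comment> \<open>With \<open>g\<close> fixed, letting \<open>n\<close> grow sends the
      coefficient to 0 and with it the energy of the perturbation, because \<open>h\<close> has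
      finite energy.\<close>
    have "(\<lambda>n. 1 / (real n + 1 + \<psi> g)) \<longlonglongrightarrow> 0"
    proof (rule tendsto_sandwich[OF _ _ tendsto_const LIMSEQ_inverse_real_of_nat])
      show "\<forall>\<^sub>F n in sequentially. 0 \<le> 1 / (real n + 1 + \<psi> g)" using \<psi>(2)[of g] by simp
      show "\<forall>\<^sub>F n in sequentially. 1 / (real n + 1 + \<psi> g) \<le> inverse (real (Suc n))"
        using \<psi>(2)[of g] by (auto simp: inverse_eq_divide intro!: always_eventually divide_left_mono)
    qed
    then have "(\<lambda>n. \<rho> (g, n)) \<longlonglongrightarrow> 0" by (simp add: \<rho>_def)
    then have "(\<lambda>n. \<bar>\<rho> (g, n)\<bar> powr p) \<longlonglongrightarrow> 0 powr p"
      using p_ge_1 by (intro tendsto_powr' tendsto_rabs_zero) auto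
    then have "(\<lambda>n. ennreal (\<bar>\<rho> (g, n)\<bar> powr p)) \<longlonglongrightarrow> ennreal (0 powr p)"
      by (rule tendsto_ennrealI)
    then have "(\<lambda>n. Lp_energy h * ennreal (\<bar>\<rho> (g, n)\<bar> powr p)) \<longlonglongrightarrow> Lp_energy h * ennreal (0 powr p)"
      using h_fin by (intro ennreal_tendsto_cmult) auto
    then have "\<forall>\<^sub>F n in sequentially. Lp_energy h * ennreal (\<bar>\<rho> (g, n)\<bar> powr p) < ennreal e"
      by (rule order_tendstoD(2)) (use e(1) in simp)
    then obtain n where n: "Lp_energy h * ennreal (\<bar>\<rho> (g, n)\<bar> powr p) < ennreal e"
      using eventually_happens' sequentially_bot by blast
    let ?x = "(g, n)"
    have x: "?x \<in> ?I" using g(1) by simp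
    have [measurable]: "f0 \<in> borel_measurable L" "g \<in> borel_measurable L"
      using F g by (auto intro: borel_measurable_L continuous_bounded_support_borel)
    have "Lp_energy (\<lambda>s. f0 s - f ?x s) = Lp_energy (\<lambda>s. (f0 s - g s) + (- \<rho> ?x) *\<^sub>R h s)"
      by (simp add: f_def algebra_simps)
    also have "\<dots> \<le> ennreal (2 powr p) * (Lp_energy (\<lambda>s. f0 s - g s) + Lp_energy (\<lambda>s. (- \<rho> ?x) *\<^sub>R h s))"
      by (intro Lp_energy_add_le) measurable
    also have "Lp_energy (\<lambda>s. (- \<rho> ?x) *\<^sub>R h s) = Lp_energy h * ennreal (\<bar>\<rho> ?x\<bar> powr p)"
      by (subst Lp_energy_scaleR) (auto simp: mult.commute)
    also have "ennreal (2 powr p) * (Lp_energy (\<lambda>s. f0 s - g s) + Lp_energy h * ennreal (\<bar>\<rho> ?x\<bar> powr p))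
        < ennreal (2 powr p) * (ennreal e + ennreal e)"
      using g(2) n by (intro ennreal_mult_strict_left_mono add_strict_mono) auto
    also have "\<dots> = ennreal (2 powr p * (e + e))"
      using e(1) by (simp add: ennreal_mult less_imp_le flip: mult_2)
    finally have less: "Lp_energy (\<lambda>s. f0 s - f ?x s) < ennreal (\<epsilon> powr p)" using e(2) by simp
    have "Lp_dist \<alpha> p v F (ae_class \<alpha> (f ?x)) = enn2real (Lp_energy (\<lambda>s. f0 s - f ?x s)) powr (1 / p)"
      unfolding F(1) by (intro Lp_dist_ae_class F(2) borel_measurable_L f_borel x)
    also have "\<dots> < \<epsilon>"
      using less \<epsilon> order.strict_trans[OF less] by (subst root_less_iff) auto
    finally show ?thesis using x unfolding S_def by blast
  qed
  ultimately show ?thesis unfolding densely_dist_chaotic_def by blast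
qed

end

theorem theorem4p5:
  fixes \<alpha> p :: real and v :: "complex \<Rightarrow> real" and K :: "nat set"
  assumes "0 < \<alpha>" and "\<alpha> < pi / 2"
    and "1 \<le> p"
    and "admissible_weight \<alpha> v"
    and "K \<subseteq> {1..}"
    and "nat_upper_density K = 1"
    and "(\<Sum>\<^sub>\<infinity>k\<in>K. \<integral>\<^sup>+s\<in>sector_annulus \<alpha> (real k) (real k + 1). ennreal (v s) \<partial>lebesgue) < \<infinity>"
  shows "densely_dist_chaotic \<alpha>
           (Lp_space \<alpha> p v :: (complex \<Rightarrow> real) set set) (Lp_dist \<alpha> p v) (translation \<alpha>)
       \<and> densely_dist_chaotic \<alpha>
           (Lp_space \<alpha> p v :: (complex \<Rightarrow> complex) set set) (Lp_dist \<alpha> p v) (translation \<alpha>)"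
proof -
  interpret weighted_sector \<alpha> p v
    by unfold_locales (fact assms)+
  show ?thesis using assms(6,7) by (intro conjI densely_dist_chaotic_Lp)
qed

end
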